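(* Let $J>0$, $h>0$, and let $f$ be a probability distribution on $\mathbb{N}=\{1,2,\dots\}$ with $\min\{k:f(k)>0\}\ge 3$ and $d_{\mathrm{ave}}=\sum_k kf(k)<\infty$. For the Configuration Model $\mathrm{CM}_n$ with degree distribution $f$, label the vertices so that their degrees satisfy $d_1\le\dots\le d_n$, put $\ell_m=\sum_{i=1}^m d_i$, and define $$\tilde m=\min\big\{1\le m\le n:\ \ell_m\ge\tfrac12\ell_n\big\}.$$ Then there is a deterministic sequence $\epsilon_n\to 0$ such that, with $\mathbb{P}_n$-probability tending to $1$ as $n\to\infty$, $$\Gamma_n^\star\ \ge\ J\,d_{\mathrm{ave}}\,I_{d_{\mathrm{ave}}}\!\left(\tfrac12\right)n-h\,\tilde m-\epsilon_n n.$$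
   Context: Configuration Model: fix $n$ and vertices $V=\{v_1,\dots,v_n\}$. Vertex $v_i$ gets a random degree $D_i$, where $D_1,\dots,D_n$ are i.i.d. with law $f$ conditioned on the event that $\sum_{i=1}^n D_i$ is even ($n$ ranges over integers for which this event has positive probability). Given the degrees, attach $D_i$ half-edges (stubs) to $v_i$ and pair all stubs by a uniform random perfect matching; each pair is an edge between the corresponding vertices (self-loops and multiple edges are allowed). The resulting multigraph is $\mathrm{CM}_n$, with law $\mathbb{P}_n$. Ising model: for a finite multigraph $G=(V,E)$ let $\Omega=\{-1,+1\}^V$ and $$\mathcal{H}(\xi)=-\frac J2\sum_{(v,w)\in E}\xi(v)\xi(w)-\frac h2\sum_{v\in V}\xi(v),$$ the first sum being over non-oriented edges counted with multiplicity. $\boxplus$ and $\boxminus$ denote the configurations identically $+1$ and $-1$. Allowed moves are between configurations that differ at exactly one vertex. For $\xi\neq\zeta$ the communication height is $\Phi(\xi,\zeta)=\min_{\gamma:\xi\to\zeta}\max_{\sigma\in\gamma}\mathcal{H}(\sigma)$, the minimum being over paths of allowed moves. The energy barrier is $\Gamma^\star=\Phi(\boxminus,\boxplus)-\mathcal{H}(\boxminus)$, and $\Gamma_n^\star$ denotes $\Gamma^\star$ for $G=\mathrm{CM}_n$. The function $I_\delta$: for $0<x\le\frac12$ and $\delta>1$, $$I_\delta(x)=\inf\Big\{0<y\le x:\ 1<x^{x(1-1/\delta)}(1-x)^{(1-x)(1-1/\delta)}(1-x-y)^{-(1-x-y)/2}(x-y)^{-(x-y)/2}y^{-y}\Big\},$$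 with the convention $0^0=1$. *)

theory Defs
  imports "HOL-Probability.Probability" "HOL-Library.Multiset"
begin

section \<open>Finite multigraphs\<close>

text \<open>An edge is the two-element multiset of its end vertices, so a self-loop at \<open>v\<close> is
  \<open>{#v, v#}\<close>; parallel edges are recorded by the multiplicity in \<open>edges\<close>.\<close>

record 'v multigraph =
  verts :: "'v set"
  edges :: "'v multiset multiset"

text \<open>A self-loop contributes two to the degree.\<close>

definition vdegree :: "'v multigraph \<Rightarrow> 'v \<Rightarrow> nat" where
  "vdegree G v = (\<Sum>e\<in>#edges G. count e v)"

definition sorted_degrees :: "'v multigraph \<Rightarrow> nat list" where
  "sorted_degrees G = sorted_list_of_multiset (image_mset (vdegree G) (mset_set (verts G)))"

text \<open>Sum of the \<open>m\<close> smallest degrees.\<close>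

definition ell :: "'v multigraph \<Rightarrow> nat \<Rightarrow> nat" where
  "ell G m = sum_list (take m (sorted_degrees G))"

definition m_tilde :: "'v multigraph \<Rightarrow> nat" where
  "m_tilde G = (LEAST m. 1 \<le> m \<and> m \<le> card (verts G) \<and>
      real (ell G m) \<ge> 1/2 * real (ell G (card (verts G))))"

section \<open>The Ising model on a finite multigraph\<close>

definition configs :: "'v multigraph \<Rightarrow> ('v \<Rightarrow> real) set" where
  "configs G = verts G \<rightarrow>\<^sub>E {-1, 1}"

text \<open>For an edge \<open>e = {#v, w#}\<close> the inner product is \<open>\<xi> v * \<xi> w\<close>, also when \<open>v = w\<close>.\<close>

definition hamiltonian :: "real \<Rightarrow> real \<Rightarrow> 'v multigraph \<Rightarrow> ('v \<Rightarrow> real) \<Rightarrow> real" where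
  "hamiltonian J h G \<xi> =
     - (J/2) * (\<Sum>e\<in>#edges G. \<Prod>v\<in>#e. \<xi> v) - (h/2) * (\<Sum>v\<in>verts G. \<xi> v)"

definition all_plus :: "'v multigraph \<Rightarrow> 'v \<Rightarrow> real" where
  "all_plus G = (\<lambda>v\<in>verts G. 1)"

definition all_minus :: "'v multigraph \<Rightarrow> 'v \<Rightarrow> real" where
  "all_minus G = (\<lambda>v\<in>verts G. - 1)"

definition allowed_move :: "'v multigraph \<Rightarrow> ('v \<Rightarrow> real) \<Rightarrow> ('v \<Rightarrow> real) \<Rightarrow> bool" where
  "allowed_move G \<sigma> \<tau> \<longleftrightarrow> \<sigma> \<in> configs G \<and> \<tau> \<in> configs G \<and> (\<exists>!v. v \<in> verts G \<and> \<sigma> v \<noteq> \<tau> v)"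

definition paths :: "'v multigraph \<Rightarrow> ('v \<Rightarrow> real) \<Rightarrow> ('v \<Rightarrow> real) \<Rightarrow> ('v \<Rightarrow> real) list set" where
  "paths G \<xi> \<zeta> = {\<gamma>. \<gamma> \<noteq> [] \<and> set \<gamma> \<subseteq> configs G \<and> hd \<gamma> = \<xi> \<and> last \<gamma> = \<zeta> \<and>
      successively (allowed_move G) \<gamma>}"

text \<open>The set of paths is infinite, but \<open>configs G\<close> is finite for finite \<open>verts G\<close>,
  so the minimum is taken over a finite set of values.\<close>

definition comm_height ::
  "real \<Rightarrow> real \<Rightarrow> 'v multigraph \<Rightarrow> ('v \<Rightarrow> real) \<Rightarrow> ('v \<Rightarrow> real) \<Rightarrow> real" where
  "comm_height J h G \<xi> \<zeta> = Min ((\<lambda>\<gamma>. Max (hamiltonian J h G ` set \<gamma>)) ` paths G \<xi> \<zeta>)"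

definition energy_barrier :: "real \<Rightarrow> real \<Rightarrow> 'v multigraph \<Rightarrow> real" where
  "energy_barrier J h G =
     comm_height J h G (all_minus G) (all_plus G) - hamiltonian J h G (all_minus G)"

section \<open>The Configuration Model\<close>

definition mean_degree :: "nat pmf \<Rightarrow> real" where
  "mean_degree f = (\<Sum>k. real k * pmf f k)"

definition iid_degrees :: "nat pmf \<Rightarrow> nat \<Rightarrow> (nat \<Rightarrow> nat) pmf" where
  "iid_degrees f n = Pi_pmf {1..n} 0 (\<lambda>_. f)"

definition even_total :: "nat \<Rightarrow> (nat \<Rightarrow> nat) set" where
  "even_total n = {D. even (\<Sum>i=1..n. D i)}"

definition admissible :: "nat pmf \<Rightarrow> nat set" where
  "admissible f = {n. measure_pmf.prob (iid_degrees f n) (even_total n) > 0}"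

definition stubs :: "nat \<Rightarrow> (nat \<Rightarrow> nat) \<Rightarrow> (nat \<times> nat) set" where
  "stubs n D = (SIGMA i:{1..n}. {1..D i})"

definition perfect_matchings :: "'a set \<Rightarrow> 'a set set set" where
  "perfect_matchings S = {M. partition_on S M \<and> (\<forall>p\<in>M. card p = 2)}"

text \<open>Each matched pair \<open>{(i, a), (j, b)}\<close> of stubs becomes the edge \<open>{#i, j#}\<close>.\<close>

definition matching_graph :: "nat \<Rightarrow> (nat \<times> nat) set set \<Rightarrow> nat multigraph" where
  "matching_graph n M =
     \<lparr>verts = {1..n}, edges = image_mset (\<lambda>p. image_mset fst (mset_set p)) (mset_set M)\<rparr>"

text \<open>Meaningful for \<open>n \<in> admissible f\<close>; otherwise \<^const>\<open>cond_pmf\<close> conditions on a null event.\<close>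

definition config_model :: "nat pmf \<Rightarrow> nat \<Rightarrow> nat multigraph pmf" where
  "config_model f n =
     bind_pmf (cond_pmf (iid_degrees f n) (even_total n)) (\<lambda>D.
       map_pmf (matching_graph n) (pmf_of_set (perfect_matchings (stubs n D))))"

section \<open>The function \<open>I\<close>\<close>

text \<open>In HOL \<open>0 powr 0 = 0\<close>, whereas the definition below needs the convention \<open>0\<^sup>0 = 1\<close>.\<close>

definition pow0 :: "real \<Rightarrow> real \<Rightarrow> real" where
  "pow0 a b = (if a = 0 \<and> b = 0 then 1 else a powr b)"

text \<open>Used for \<open>\<delta> > 1\<close> and \<open>0 < x \<le> 1/2\<close>; the set is then nonempty (it contains
  \<open>y = x * (1 - x)\<close>), so \<^const>\<open>Inf\<close> on the reals is the genuine infimum.\<close>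

definition I_fun :: "real \<Rightarrow> real \<Rightarrow> real" where
  "I_fun \<delta> x = Inf {y. 0 < y \<and> y \<le> x \<and>
     1 < pow0 x (x * (1 - 1/\<delta>)) * pow0 (1 - x) ((1 - x) * (1 - 1/\<delta>))
       * pow0 (1 - x - y) (- (1 - x - y) / 2) * pow0 (x - y) (- (x - y) / 2) * pow0 y (- y)}"

end

theory Submission
  imports Defs
begin

text \<open>
  Write \<open>A\<close> for the set of plus spins of a configuration, \<open>vol A\<close> for the sum of the degrees over \<open>A\<close>
  and \<open>L\<close> for the sum of all degrees. Relative to all spins minus, the energy is
  \<open>J \<cdot> |cut of A| - h \<cdot> |A|\<close> (\<open>hamiltonian_matching_graph\<close>). A path from all minus to all plus
  flips one spin at a time, so some configuration on it has \<open>vol A\<close> just below \<open>L/2\<close>, with an error of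
  at most the maximal degree. Such an \<open>A\<close> has at most \<open>m_tilde\<close> vertices, because the \<open>m_tilde\<close>
  smallest degrees already fill one half of \<open>L\<close>. It remains to show that with high probability
  \<^emph>\<open>every\<close> \<open>A\<close> with \<open>vol A\<close> close to \<open>L/2\<close> has a cut of at least about \<open>L \<cdot> I(1/2)\<close> edges
  (\<open>energy_barrier_matching_graph_ge\<close>).

  Let \<open>L = 2r\<close> and let \<open>T\<close> be the set of stubs of such an \<open>A\<close>, enlarged to exactly \<open>r\<close> stubs at the cost of
  at most the maximal degree in the cut. By symmetry, the number of pairs that a uniform matching \<open>M\<close>
  cuts on a fixed \<open>T\<close> has the same law as the number that a fixed \<open>M\<close> cuts on a
  uniform \<open>r\<close>-element set \<open>T\<close>. If \<open>T\<close> ranges over all subsets of the \<open>2r\<close> stubs instead, the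
  \<open>r\<close> pairs of \<open>M\<close> are cut independently with probability one half, which gives the generating function
  \<open>(2 + 2z)^r\<close>; and the \<open>r\<close>-element sets are at least the fraction \<open>1/(2r)\<close> of all subsets. Hence
  the probability of at most \<open>K\<close> cut pairs is at most \<open>2r ((1+z)/2)^r z^(-K)\<close> for every
  \<open>0 < z \<le> 1\<close> (\<open>prob_crossing_le\<close>). This replaces Stirling asymptotics for the exact count of matchings.

  There are at most \<open>2^n\<close> sets \<open>A\<close>, and \<open>n\<close> is about \<open>L/\<delta>\<close> for the mean degree \<open>\<delta>\<close>. With
  \<open>K = 2yr\<close> and the optimal \<open>z = y/(1/2 - y)\<close>, the union bound is, up to the factor \<open>2r\<close>, the \<open>L\<close>-th power of the expression
  that defines \<open>I_fun \<delta> (1/2)\<close>. That expression is at most \<open>1\<close> for \<open>y < I_fun \<delta> (1/2)\<close>, and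
  a slightly smaller \<open>K\<close> turns this into exponential decay (\<open>exists_contracting_parameters\<close>).

  The degrees enter through the bound \<open>L \<ge> (\<delta> - \<eta>) n\<close> and the absence of degrees above \<open>\<eta> n\<close>. Both
  hold with high probability for independent degrees of finite mean, and conditioning on an even total costs
  a bounded factor (\<open>prob_even_total_bounded_below\<close>). The result for each fixed error \<open>\<epsilon>\<close> gives
  a null sequence by a diagonal choice.
\<close>

section \<open>Random perfect matchings and the pairs they cut\<close>

definition crossing :: "'a set set \<Rightarrow> 'a set \<Rightarrow> nat" where
  "crossing M T = card {p \<in> M. p \<inter> T \<noteq> {} \<and> p - T \<noteq> {}}"

lemma finite_perfect_matchings: "finite S \<Longrightarrow> finite (perfect_matchings S)"
  using finitely_many_partition_on[of S] by (auto simp: perfect_matchings_def)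

lemma perfect_matchingD:
  assumes "M \<in> perfect_matchings S"
  shows "\<Union>M = S" "disjoint M" "\<And>p. p \<in> M \<Longrightarrow> card p = 2" "\<And>p. p \<in> M \<Longrightarrow> finite p"
  using assms by (auto simp: perfect_matchings_def partition_on_def intro!: card_ge_0_finite)

lemma finite_perfect_matching: "M \<in> perfect_matchings S \<Longrightarrow> finite S \<Longrightarrow> finite M"
  using finite_elements[of S M] by (auto simp: perfect_matchings_def)

lemma card_perfect_matching:
  assumes "M \<in> perfect_matchings S" and "finite S"
  shows "card S = 2 * card M"
proof -
  have "card (\<Union>M) = sum card M"
    using perfect_matchingD[OF assms(1)] by (intro card_Union_disjoint) auto
  also have "\<dots> = (\<Sum>p\<in>M. 2)"
    using perfect_matchingD[OF assms(1)] by (intro sum.cong) auto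
  finally show ?thesis
    using perfect_matchingD(1)[OF assms(1)] by simp
qed

text \<open>Needed because \<^const>\<open>pmf_of_set\<close> describes the uniform distribution on
  nonempty sets only.\<close>

lemma perfect_matchings_nonempty:
  assumes "finite S" and "card S = 2 * r"
  shows "perfect_matchings S \<noteq> {}"
  using assms
proof (induction r arbitrary: S)
  case 0
  then have "{} \<in> perfect_matchings S"
    by (simp add: perfect_matchings_def partition_on_def)
  then show ?case by blast
next
  case (Suc r)
  have "2 \<le> card S" using Suc.prems by simp
  then obtain p where p: "p \<subseteq> S" "card p = 2"
    using obtain_subset_with_card_n by metis
  have "finite p" using p Suc.prems finite_subset by blast
  then have "card (S - p) = 2 * r"
    using p Suc.prems by (simp add: card_Diff_subset)
  then obtain M where M: "M \<in> perfect_matchings (S - p)"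
    using Suc.IH[of "S - p"] Suc.prems by auto
  have "p \<noteq> {}" using p by auto
  then have "insert p M \<in> perfect_matchings S"
    using M p by (auto simp: perfect_matchings_def partition_on_def disjoint_def)
  then show ?case by blast
qed

lemma set_pmf_of_perfect_matchings:
  assumes "finite S" and "card S = 2 * r"
  shows "set_pmf (pmf_of_set (perfect_matchings S)) = perfect_matchings S"
  using perfect_matchings_nonempty[OF assms] finite_perfect_matchings[OF assms(1)] by simp

lemma crossing_insert:
  assumes "finite M" and "p \<notin> M"
  shows "crossing (insert p M) T = crossing M T + (if p \<inter> T \<noteq> {} \<and> p - T \<noteq> {} then 1 else 0)"
proof -
  have "{q \<in> insert p M. q \<inter> T \<noteq> {} \<and> q - T \<noteq> {}} =
    (if p \<inter> T \<noteq> {} \<and> p - T \<noteq> {} then insert p {q \<in> M. q \<inter> T \<noteq> {} \<and> q - T \<noteq> {}}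
     else {q \<in> M. q \<inter> T \<noteq> {} \<and> q - T \<noteq> {}})" by auto
  then show ?thesis using assms unfolding crossing_def by simp
qed

lemma crossing_Un_eq:
  assumes "X \<inter> \<Union>M = {}"
  shows "crossing M (X \<union> Y) = crossing M Y"
  unfolding crossing_def using assms by (intro arg_cong[where f = card]) blast

text \<open>Each pair contributes the factor \<open>2 + 2z\<close>: two of its four traces on
  \<open>T\<close> cut the pair, two do not.\<close>

lemma crossing_generating_function:
  fixes z :: real
  assumes "finite M" and "disjoint M" and "\<And>p. p \<in> M \<Longrightarrow> card p = 2"
  shows "(\<Sum>T\<in>Pow (\<Union>M). z ^ crossing M T) = (2 + 2 * z) ^ card M"
  using assms
proof (induction M)
  case empty
  then show ?case by (simp add: crossing_def)
next
  case (insert p M)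
  let ?U = "\<Union>M"
  obtain a b where p: "p = {a, b}" "a \<noteq> b"
    using insert.prems(2)[of p] by (auto simp: card_2_iff)
  have disj: "p \<inter> ?U = {}"
    using insert.prems(1) insert.hyps by (auto simp: disjoint_def)
  have fin: "finite ?U"
    using insert by (metis card_ge_0_finite finite_Union insertCI zero_less_numeral)
  have bij: "bij_betw (\<lambda>(X, Y). X \<union> Y) (Pow p \<times> Pow ?U) (Pow (p \<union> ?U))"
    by (rule bij_betwI[where g = "\<lambda>T. (T \<inter> p, T \<inter> ?U)"]) (use disj in auto)
  have weight: "z ^ crossing (insert p M) (X \<union> Y) =
      z ^ crossing M Y * z ^ (if p \<inter> X \<noteq> {} \<and> p - X \<noteq> {} then 1 else 0)"
    if "X \<in> Pow p" "Y \<in> Pow ?U" for X Y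
  proof -
    have "X \<inter> \<Union>M = {}" and "p \<inter> (X \<union> Y) = p \<inter> X" and "p - (X \<union> Y) = p - X"
      using that disj by auto
    then show ?thesis
      by (subst crossing_insert[OF insert.hyps]) (simp add: crossing_Un_eq)
  qed
  have "(\<Sum>T\<in>Pow (\<Union>(insert p M)). z ^ crossing (insert p M) T) =
      (\<Sum>(X, Y)\<in>Pow p \<times> Pow ?U. z ^ crossing (insert p M) (X \<union> Y))"
    using sum.reindex_bij_betw[OF bij, of "\<lambda>T. z ^ crossing (insert p M) T"]
    by (simp add: case_prod_unfold)
  also have "\<dots> = (\<Sum>(X, Y)\<in>Pow p \<times> Pow ?U.
      z ^ crossing M Y * z ^ (if p \<inter> X \<noteq> {} \<and> p - X \<noteq> {} then 1 else 0))"
    using weight by (intro sum.cong) auto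
  also have "\<dots> = (\<Sum>X\<in>Pow p. \<Sum>Y\<in>Pow ?U.
      z ^ crossing M Y * z ^ (if p \<inter> X \<noteq> {} \<and> p - X \<noteq> {} then 1 else 0))"
    using fin p by (subst sum.cartesian_product) auto
  also have "\<dots> = (\<Sum>X\<in>Pow p. z ^ (if p \<inter> X \<noteq> {} \<and> p - X \<noteq> {} then 1 else 0)) *
      (\<Sum>Y\<in>Pow ?U. z ^ crossing M Y)"
    unfolding sum_product by (intro sum.cong refl mult.commute)
  also have "(\<Sum>Y\<in>Pow ?U. z ^ crossing M Y) = (2 + 2 * z) ^ card M"
    using insert by (intro insert.IH) (auto simp: disjoint_def)
  also have "(\<Sum>X\<in>Pow p. z ^ (if p \<inter> X \<noteq> {} \<and> p - X \<noteq> {} then 1 else 0)) = 2 + 2 * z"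
  proof -
    have "Pow p = {{}, {a}, {b}, {a, b}}" using p by auto
    moreover have "{b} - {a} \<noteq> {}" using p by auto
    ultimately show ?thesis using p by (auto simp: doubleton_eq_iff)
  qed
  finally show ?case using insert.hyps by simp
qed

text \<open>A bijection of \<open>S\<close> that carries \<open>T\<close> to \<open>T'\<close> acts
  injectively on matchings and preserves the number of cut pairs. By exchanging the two sets one gets
  equality; the inequality suffices for averaging.\<close>

lemma card_matchings_crossing_le:
  assumes "finite S" and "T \<subseteq> S" and "T' \<subseteq> S" and "card T = card T'"
  shows "card {M \<in> perfect_matchings S. real (crossing M T) \<le> K} \<le>
         card {M \<in> perfect_matchings S. real (crossing M T') \<le> K}"
proof -
  have finT: "finite T" "finite T'" using assms finite_subset by auto
  have "card (S - T) = card (S - T')"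
    using assms finT by (simp add: card_Diff_subset)
  then obtain g where g: "bij_betw g (S - T) (S - T')"
    using assms(1) finite_same_card_bij[of "S - T" "S - T'"] by auto
  obtain f where f: "bij_betw f T T'"
    using assms(4) finT finite_same_card_bij[of T T'] by auto
  define \<pi> where "\<pi> x = (if x \<in> T then f x else g x)" for x
  have bij_T: "bij_betw \<pi> T T'"
    using f by (rule bij_betw_cong[THEN iffD1, rotated]) (simp add: \<pi>_def)
  have bij_TC: "bij_betw \<pi> (S - T) (S - T')"
    using g by (rule bij_betw_cong[THEN iffD1, rotated]) (simp add: \<pi>_def)
  have bij: "bij_betw \<pi> S S"
    using bij_betw_combine[OF bij_T bij_TC] assms(2,3) by (simp add: Un_absorb1)
  have inj: "inj_on \<pi> S" and im: "\<pi> ` S = S"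
    using bij by (auto simp: bij_betw_def)
  have im_T: "\<pi> x \<in> T' \<longleftrightarrow> x \<in> T" if "x \<in> S" for x
    using that bij_T bij_TC by (auto simp: bij_betw_def)
  have image_PM: "(`) \<pi> ` M \<in> perfect_matchings S" if "M \<in> perfect_matchings S" for M
  proof -
    have sub: "M \<subseteq> Pow S" using that by (auto simp: perfect_matchings_def partition_on_def)
    have M: "partition_on S M" "{} \<notin> M" "\<forall>p\<in>M. card p = 2"
      using that by (auto simp: perfect_matchings_def partition_on_def)
    have "partition_on S ((`) \<pi> ` M - {{}})"
      using partition_on_inj_image[OF M(1) inj] unfolding im .
    moreover have "(`) \<pi> ` M - {{}} = (`) \<pi> ` M"
      using M(2) by auto
    moreover have "card (\<pi> ` p) = 2" if "p \<in> M" for p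
      using card_image[OF inj_on_subset[OF inj]] sub M(3) that by (metis PowD subsetD)
    ultimately show ?thesis
      by (auto simp: perfect_matchings_def)
  qed
  have inj_Pow: "inj_on ((`) \<pi>) (Pow S)"
    using inj by (simp add: inj_on_image_Pow)
  have image_crossing: "crossing ((`) \<pi> ` M) T' = crossing M T" if "M \<in> perfect_matchings S" for M
  proof -
    have sub: "M \<subseteq> Pow S" using that by (auto simp: perfect_matchings_def partition_on_def)
    have "\<pi> ` p \<inter> T' = \<pi> ` (p \<inter> T)" and "\<pi> ` p - T' = \<pi> ` (p - T)" if "p \<in> M" for p
      using im_T sub that by (auto simp: subset_iff)
    then have "\<pi> ` p \<inter> T' \<noteq> {} \<and> \<pi> ` p - T' \<noteq> {} \<longleftrightarrow> p \<inter> T \<noteq> {} \<and> p - T \<noteq> {}" if "p \<in> M" for p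
      using that by simp
    then have same: "{p \<in> M. \<pi> ` p \<inter> T' \<noteq> {} \<and> \<pi> ` p - T' \<noteq> {}} = {p \<in> M. p \<inter> T \<noteq> {} \<and> p - T \<noteq> {}}"
      by (intro Collect_cong conj_cong[OF refl])
    have filter_image: "{q \<in> F ` M. P q} = F ` {p \<in> M. P (F p)}" for F :: "'a set \<Rightarrow> 'a set" and P
      by blast
    have "inj_on ((`) \<pi>) {p \<in> M. p \<inter> T \<noteq> {} \<and> p - T \<noteq> {}}"
      using sub by (intro inj_on_subset[OF inj_Pow]) blast
    then show ?thesis
      unfolding crossing_def filter_image same by (rule card_image)
  qed
  show ?thesis
  proof (rule card_inj_on_le[where f = "\<lambda>M. (`) \<pi> ` M"])
    show "inj_on (\<lambda>M. (`) \<pi> ` M) {M \<in> perfect_matchings S. real (crossing M T) \<le> K}"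
    proof (rule inj_on_subset[OF inj_on_image_Pow[OF inj_Pow]])
      show "{M \<in> perfect_matchings S. real (crossing M T) \<le> K} \<subseteq> Pow (Pow S)"
        by (auto simp: perfect_matchings_def partition_on_def)
    qed
    show "finite {M \<in> perfect_matchings S. real (crossing M T') \<le> K}"
      using finite_perfect_matchings[OF assms(1)] by simp
  qed (use image_PM image_crossing in auto)
qed

text \<open>Markov's inequality for \<open>z ^ crossing M T\<close>, which is at least \<open>z powr
  K\<close> when at most \<open>K\<close> pairs are cut.\<close>

lemma card_subsets_crossing_le:
  fixes z K :: real
  assumes "M \<in> perfect_matchings S" and "finite S" and "card S = 2 * r" and "0 < z" and "z \<le> 1"
  shows "card {T \<in> Pow S. real (crossing M T) \<le> K} \<le> (2 + 2 * z) ^ r * z powr - K"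
proof -
  have "real (card {T \<in> Pow S. real (crossing M T) \<le> K}) * z powr K =
      (\<Sum>T\<in>{T \<in> Pow S. real (crossing M T) \<le> K}. z powr K)" by simp
  also have "\<dots> \<le> (\<Sum>T\<in>{T \<in> Pow S. real (crossing M T) \<le> K}. z ^ crossing M T)"
    using assms(4,5) by (intro sum_mono) (auto simp flip: powr_realpow intro: powr_mono')
  also have "\<dots> \<le> (\<Sum>T\<in>Pow S. z ^ crossing M T)"
    using assms by (intro sum_mono2) auto
  also have "\<dots> = (2 + 2 * z) ^ r"
    using crossing_generating_function[of M z] perfect_matchingD[OF assms(1)]
      finite_perfect_matching[OF assms(1,2)] card_perfect_matching[OF assms(1,2)] assms(3) by simp
  finally have "real (card {T \<in> Pow S. real (crossing M T) \<le> K}) * z powr K \<le> (2 + 2 * z) ^ r" .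
  then show ?thesis using assms(4) by (simp add: powr_minus field_simps)
qed

text \<open>Double counting of the pairs \<open>(M, T')\<close> with \<open>card T' = r\<close>. For each
  \<open>T'\<close> there are equally many matchings by symmetry; for each \<open>M\<close> the sets
  \<open>T'\<close> are bounded by forgetting the condition \<open>card T' = r\<close>, which loses only
  the factor \<open>4 ^ r / (2r choose r) \<le> 2r\<close>.\<close>

lemma prob_crossing_le:
  fixes z K :: real
  assumes "finite S" and "card S = 2 * r" and "0 < r" and "T \<subseteq> S" and "card T = r"
    and "0 < z" and "z \<le> 1"
  shows "measure_pmf.prob (pmf_of_set (perfect_matchings S)) {M. real (crossing M T) \<le> K}
         \<le> 2 * real r * ((1 + z) / 2) ^ r * z powr - K"
proof -
  let ?PM = "perfect_matchings S"
  let ?c = "\<lambda>T. card {M \<in> ?PM. real (crossing M T) \<le> K}"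
  let ?B = "(2 + 2 * z) ^ r * z powr - K"
  let ?R = "{T' \<in> Pow S. card T' = r}"
  note fin = finite_perfect_matchings[OF assms(1)]
  have ne: "?PM \<noteq> {}" using perfect_matchings_nonempty assms(1,2) by blast
  have "((2 * r) choose r) * ?c T = (\<Sum>T'\<in>?R. ?c T)"
    using assms n_subsets[of S r] by simp
  also have "\<dots> \<le> (\<Sum>T'\<in>?R. ?c T')"
    using assms by (intro sum_mono card_matchings_crossing_le) auto
  also have "\<dots> = (\<Sum>T'\<in>?R. \<Sum>M\<in>?PM. if real (crossing M T') \<le> K then 1 else 0)"
    using fin by (simp add: sum.If_cases Int_def)
  also have "\<dots> = (\<Sum>M\<in>?PM. \<Sum>T'\<in>?R. if real (crossing M T') \<le> K then 1 else 0)"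
    by (rule sum.swap)
  also have "\<dots> \<le> (\<Sum>M\<in>?PM. \<Sum>T'\<in>Pow S. if real (crossing M T') \<le> K then 1 else 0)"
    using assms(1) by (intro sum_mono sum_mono2) auto
  also have "\<dots> = (\<Sum>M\<in>?PM. card {T' \<in> Pow S. real (crossing M T') \<le> K})"
    using assms(1) by (simp add: sum.If_cases Int_def)
  finally have "real (((2 * r) choose r) * ?c T) \<le>
      (\<Sum>M\<in>?PM. real (card {T' \<in> Pow S. real (crossing M T') \<le> K}))"
    by (simp only: of_nat_sum[symmetric] of_nat_le_iff)
  also have "\<dots> \<le> (\<Sum>M\<in>?PM. ?B)"
    using assms by (intro sum_mono card_subsets_crossing_le) auto
  finally have "real ((2 * r) choose r) * ?c T \<le> card ?PM * ?B" by simp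
  moreover have "4 ^ r / (2 * real r) * ?c T \<le> real ((2 * r) choose r) * ?c T"
    using central_binomial_lower_bound[OF assms(3)] by (intro mult_right_mono) auto
  ultimately have "4 ^ r / (2 * real r) * ?c T \<le> card ?PM * ?B" by linarith
  then have "?c T \<le> card ?PM * (2 * real r * (?B / 4 ^ r))"
    using assms(3) by (simp add: field_simps)
  also have "?B / 4 ^ r = ((1 + z) / 2) ^ r * z powr - K"
  proof -
    have "(2 + 2 * z) ^ r / 4 ^ r = ((1 + z) / 2) ^ r"
      unfolding power_divide[symmetric] by (rule arg_cong[where f = "\<lambda>x. x ^ r"]) simp
    then show ?thesis by (simp add: field_simps)
  qed
  finally have "?c T \<le> card ?PM * (2 * real r * ((1 + z) / 2) ^ r * z powr - K)"
    by (simp add: mult.assoc)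
  moreover have "card ?PM > 0" using ne fin by (simp add: card_gt_0_iff)
  ultimately have "?c T / card ?PM \<le> 2 * real r * ((1 + z) / 2) ^ r * z powr - K"
    by (simp add: field_simps)
  then show ?thesis
    using ne fin by (simp add: measure_pmf_of_set Int_def)
qed

text \<open>A pair that is cut only after enlarging \<open>T\<close> contains a new element, and distinct
  pairs contain distinct ones.\<close>

lemma crossing_superset_le:
  assumes M: "disjoint M" "finite M" and T: "T \<subseteq> T'" "finite T'"
  shows "crossing M T' \<le> crossing M T + card (T' - T)"
proof -
  let ?C = "\<lambda>T. {p \<in> M. p \<inter> T \<noteq> {} \<and> p - T \<noteq> {}}"
  let ?N = "{p \<in> M. p \<inter> (T' - T) \<noteq> {}}"
  have "?C T' \<subseteq> ?C T \<union> ?N" using T(1) by auto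
  then have "crossing M T' \<le> card (?C T \<union> ?N)"
    unfolding crossing_def using M(2) by (intro card_mono) auto
  also have "\<dots> \<le> crossing M T + card ?N"
    unfolding crossing_def by (rule card_Un_le)
  also have "card ?N \<le> card (T' - T)"
  proof (rule card_inj_on_le)
    let ?f = "\<lambda>p. SOME x. x \<in> p \<inter> (T' - T)"
    have f: "?f p \<in> p \<inter> (T' - T)" if "p \<in> ?N" for p
      using that someI_ex[of "\<lambda>x. x \<in> p \<inter> (T' - T)"] by blast
    then show "?f ` ?N \<subseteq> T' - T" by blast
    show "inj_on ?f ?N"
    proof (rule inj_onI)
      fix p q assume "p \<in> ?N" "q \<in> ?N" "?f p = ?f q"
      then have "?f p \<in> p \<inter> q" using f[of p] f[of q] by auto
      then show "p = q" using \<open>p \<in> ?N\<close> \<open>q \<in> ?N\<close> M(1) by (auto simp: disjoint_def)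
    qed
  qed (use T in simp)
  finally show ?thesis by simp
qed

text \<open>Enlarging \<open>T\<close> to exactly one half of \<open>S\<close> reduces the claim to
  \<open>prob_crossing_le\<close>, with \<open>b\<close> added to the threshold.\<close>

lemma prob_crossing_near_half_le:
  fixes z b Y :: real
  assumes S: "finite S" "card S = 2 * r" and r: "0 < r"
    and T: "T \<subseteq> S" "card T \<le> r" "real r \<le> card T + b"
    and z: "0 < z" "z \<le> 1"
  shows "measure_pmf.prob (pmf_of_set (perfect_matchings S)) {M. real (crossing M T) < Y}
         \<le> 2 * real r * ((1 + z) / 2) ^ r * z powr - (Y + b)"
proof -
  let ?PM = "perfect_matchings S"
  have fin: "finite T" using S T finite_subset by blast
  obtain T' where T': "T \<subseteq> T'" "T' \<subseteq> S" "card T' = r"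
    using exists_subset_between[of T r S] S T by auto
  have finT': "finite T'" using S(1) T'(2) finite_subset by blast
  have "card (T' - T) = r - card T" using T' fin by (simp add: card_Diff_subset)
  then have excess: "real (card (T' - T)) \<le> b" using T by simp
  have supp: "set_pmf (pmf_of_set ?PM) = ?PM"
    by (rule set_pmf_of_perfect_matchings[OF S])
  have "real (crossing M T') \<le> Y + b" if M: "M \<in> ?PM" "real (crossing M T) < Y" for M
  proof -
    have "crossing M T' \<le> crossing M T + card (T' - T)"
      using perfect_matchingD(2)[OF M(1)] finite_perfect_matching[OF M(1) S(1)] T'(1) finT'
      by (intro crossing_superset_le) auto
    then have "real (crossing M T') \<le> real (crossing M T) + real (card (T' - T))"
      by linarith
    then show ?thesis using M(2) excess by linarith
  qed
  then have "measure_pmf.prob (pmf_of_set ?PM) {M. real (crossing M T) < Y}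
      \<le> measure_pmf.prob (pmf_of_set ?PM) {M. real (crossing M T') \<le> Y + b}"
    by (intro measure_pmf.finite_measure_mono_AE) (auto simp: AE_measure_pmf_iff supp)
  also have "\<dots> \<le> 2 * real r * ((1 + z) / 2) ^ r * z powr - (Y + b)"
    using S r T' z by (intro prob_crossing_le) auto
  finally show ?thesis .
qed

section \<open>The Ising energy on the graph of a matching\<close>

lemma stubs_finite: "finite (stubs n D)"
  by (simp add: stubs_def)

lemma card_stubs_over:
  assumes "A \<subseteq> {1..n}"
  shows "card {s \<in> stubs n D. fst s \<in> A} = (\<Sum>v\<in>A. D v)"
proof -
  have "{s \<in> stubs n D. fst s \<in> A} = (SIGMA i:A. {1..D i})"
    using assms by (auto simp: stubs_def)
  moreover have "finite A" using assms finite_subset by blast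
  ultimately show ?thesis by simp
qed

lemma card_stubs: "card (stubs n D) = (\<Sum>v=1..n. D v)"
  by (simp add: stubs_def)

lemma verts_matching_graph [simp]: "verts (matching_graph n M) = {1..n}"
  by (simp add: matching_graph_def)

lemma sum_edges_matching_graph:
  assumes "finite M"
  shows "(\<Sum>e\<in>#edges (matching_graph n M). F e) = (\<Sum>p\<in>M. F (image_mset fst (mset_set p)))"
  using assms by (simp add: matching_graph_def image_mset.compositionality comp_def sum_unfold_sum_mset)

lemma vdegree_matching_graph:
  assumes M: "M \<in> perfect_matchings (stubs n D)" and v: "v \<in> {1..n}"
  shows "vdegree (matching_graph n M) v = D v"
proof -
  note fin = finite_perfect_matching[OF M stubs_finite]
  have "vdegree (matching_graph n M) v = (\<Sum>p\<in>M. count (image_mset fst (mset_set p)) v)"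
    unfolding vdegree_def by (rule sum_edges_matching_graph[OF fin])
  also have "\<dots> = (\<Sum>p\<in>M. card {s \<in> p. fst s = v})"
  proof (intro sum.cong refl)
    fix p assume "p \<in> M"
    then have "finite p" using perfect_matchingD[OF M] by blast
    then show "count (image_mset fst (mset_set p)) v = card {s \<in> p. fst s = v}"
      by (simp add: count_image_mset' Int_def conj_commute eq_commute)
  qed
  also have "\<dots> = card (\<Union>p\<in>M. {s \<in> p. fst s = v})"
    using perfect_matchingD[OF M] fin
    by (intro card_UN_disjoint[symmetric]) (auto simp: disjoint_def)
  also have "(\<Union>p\<in>M. {s \<in> p. fst s = v}) = {s \<in> stubs n D. fst s \<in> {v}}"
    using perfect_matchingD(1)[OF M] by auto
  also have "card \<dots> = D v"
    using card_stubs_over[of "{v}" n D] v by simp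
  finally show ?thesis .
qed

text \<open>An edge contributes \<open>1 - 2\<close> to the interaction if its pair of stubs is cut by
  the plus stubs and \<open>1\<close> otherwise; this includes self-loops, whose pairs are never
  cut.\<close>

lemma hamiltonian_matching_graph:
  assumes M: "M \<in> perfect_matchings (stubs n D)" and \<sigma>: "\<sigma> \<in> configs (matching_graph n M)"
  shows "hamiltonian J h (matching_graph n M) \<sigma> - hamiltonian J h (matching_graph n M) (all_minus (matching_graph n M))
    = J * crossing M {s \<in> stubs n D. fst s \<in> {v \<in> {1..n}. \<sigma> v = 1}} - h * card {v \<in> {1..n}. \<sigma> v = 1}"
proof -
  let ?G = "matching_graph n M"
  let ?A = "{v \<in> {1..n}. \<sigma> v = 1}"
  let ?T = "{s \<in> stubs n D. fst s \<in> ?A}"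
  let ?cut = "\<lambda>p. p \<inter> ?T \<noteq> {} \<and> p - ?T \<noteq> {}"
  note fin = finite_perfect_matching[OF M stubs_finite]
  have vals: "\<sigma> v = 1 \<or> \<sigma> v = - 1" if "v \<in> {1..n}" for v
    using \<sigma> that by (auto simp: configs_def PiE_iff)
  have pair: "\<exists>s t. p = {s, t} \<and> s \<noteq> t \<and> s \<in> stubs n D \<and> t \<in> stubs n D" if "p \<in> M" for p
    using perfect_matchingD(1,3)[OF M] that by (fastforce simp: card_2_iff)
  have st: "fst s \<in> {1..n}" if "s \<in> stubs n D" for s
    using that by (auto simp: stubs_def)
  have prod_\<sigma>: "(\<Prod>v\<in>#image_mset fst (mset_set p). \<sigma> v) = 1 - (if ?cut p then 2 else 0)"
    if "p \<in> M" for p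
  proof -
    obtain s t where p: "p = {s, t}" "s \<noteq> t" "s \<in> stubs n D" "t \<in> stubs n D"
      using pair[OF \<open>p \<in> M\<close>] by blast
    have cut: "?cut p \<longleftrightarrow> (\<sigma> (fst s) = 1) \<noteq> (\<sigma> (fst t) = 1)"
      using p st by auto
    show ?thesis
      unfolding cut using p vals[OF st[OF p(3)]] vals[OF st[OF p(4)]] by auto
  qed
  have prod_minus: "(\<Prod>v\<in>#image_mset fst (mset_set p). all_minus ?G v) = 1" if "p \<in> M" for p
  proof -
    obtain s t where "p = {s, t}" "s \<noteq> t" "s \<in> stubs n D" "t \<in> stubs n D"
      using pair[OF \<open>p \<in> M\<close>] by blast
    then show ?thesis using st by (auto simp: all_minus_def)
  qed
  have edges_\<sigma>: "(\<Sum>e\<in>#edges ?G. \<Prod>v\<in>#e. \<sigma> v) = card M - 2 * real (crossing M ?T)"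
  proof -
    have "(\<Sum>e\<in>#edges ?G. \<Prod>v\<in>#e. \<sigma> v) = (\<Sum>p\<in>M. 1 - (if ?cut p then 2 else (0::real)))"
      unfolding sum_edges_matching_graph[OF fin] by (intro sum.cong refl prod_\<sigma>)
    also have "\<dots> = card M - (\<Sum>p\<in>M. if ?cut p then 2 else (0::real))"
      by (simp add: sum_subtractf)
    also have "(\<Sum>p\<in>M. if ?cut p then 2 else (0::real)) = 2 * real (crossing M ?T)"
      unfolding crossing_def by (subst sum.If_cases[OF fin]) (simp add: Int_def)
    finally show ?thesis .
  qed
  have edges_minus: "(\<Sum>e\<in>#edges ?G. \<Prod>v\<in>#e. all_minus ?G v) = card M"
  proof -
    have "(\<Sum>e\<in>#edges ?G. \<Prod>v\<in>#e. all_minus ?G v) = (\<Sum>p\<in>M. 1)"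
      unfolding sum_edges_matching_graph[OF fin] by (intro sum.cong refl prod_minus)
    then show ?thesis by simp
  qed
  have spins_\<sigma>: "(\<Sum>v=1..n. \<sigma> v) = 2 * real (card ?A) - n"
  proof -
    have "(\<Sum>v=1..n. \<sigma> v) = (\<Sum>v=1..n. (if \<sigma> v = 1 then 2 else 0) - (1::real))"
    proof (intro sum.cong refl)
      fix v assume "v \<in> {1..n}"
      then show "\<sigma> v = (if \<sigma> v = 1 then 2 else 0) - 1" using vals[of v] by auto
    qed
    also have "\<dots> = (\<Sum>v=1..n. if \<sigma> v = 1 then 2 else (0::real)) - n"
      by (simp add: sum_subtractf)
    also have "(\<Sum>v=1..n. if \<sigma> v = 1 then 2 else (0::real)) = 2 * real (card ?A)"
      by (subst sum.If_cases) (simp_all add: Int_def)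
    finally show ?thesis .
  qed
  have spins_minus: "(\<Sum>v=1..n. all_minus ?G v) = - real n"
    by (simp add: all_minus_def)
  show ?thesis
    unfolding hamiltonian_def verts_matching_graph edges_\<sigma> edges_minus spins_\<sigma> spins_minus
    by (simp add: field_simps)
qed

text \<open>Without a path the minimum in \<^const>\<open>comm_height\<close> would be over the empty set
  and hence meaningless.\<close>

lemma paths_minus_plus_nonempty:
  assumes "finite (verts G)"
  shows "paths G (all_minus G) (all_plus G) \<noteq> {}"
proof -
  obtain vs where vs: "set vs = verts G" "distinct vs"
    using finite_distinct_list[OF assms] by blast
  define conf :: "nat \<Rightarrow> 'a \<Rightarrow> real" where
    "conf k = (\<lambda>v\<in>verts G. if v \<in> set (take k vs) then 1 else - 1)" for k
  let ?\<gamma> = "map conf [0..<Suc (length vs)]"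
  have conf: "conf k \<in> configs G" for k
    by (auto simp: conf_def configs_def)
  have move: "allowed_move G (conf k) (conf (Suc k))" if k: "k < length vs" for k
  proof -
    have mem: "vs ! k \<in> verts G" using vs(1) nth_mem[OF k] by simp
    have "distinct (take (Suc k) vs)" using vs(2) by (rule distinct_take)
    then have new: "vs ! k \<notin> set (take k vs)"
      unfolding take_Suc_conv_app_nth[OF k] by simp
    have differ: "conf k v \<noteq> conf (Suc k) v \<longleftrightarrow> v = vs ! k" if "v \<in> verts G" for v
      using that new unfolding conf_def take_Suc_conv_app_nth[OF k] by auto
    show ?thesis
      unfolding allowed_move_def using conf differ mem by blast
  qed
  have "?\<gamma> \<in> paths G (all_minus G) (all_plus G)"
    unfolding paths_def
  proof (intro CollectI conjI)
    show "hd ?\<gamma> = all_minus G"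
      by (simp add: conf_def all_minus_def hd_map del: upt_Suc)
    show "last ?\<gamma> = all_plus G"
      using vs by (auto simp: conf_def all_plus_def)
    show "successively (allowed_move G) ?\<gamma>"
      using move by (auto simp: successively_conv_nth simp del: upt_Suc)
  qed (use conf in auto)
  then show ?thesis by blast
qed

text \<open>All path maxima are energies of the finitely many configurations, so the minimum over paths
  is one over a finite set.\<close>

lemma energy_barrier_ge:
  assumes fin: "finite (verts G)"
    and path: "\<And>\<gamma>. \<gamma> \<in> paths G (all_minus G) (all_plus G) \<Longrightarrow>
      \<exists>\<sigma>\<in>set \<gamma>. X \<le> hamiltonian J h G \<sigma> - hamiltonian J h G (all_minus G)"
  shows "X \<le> energy_barrier J h G"
proof -
  let ?P = "paths G (all_minus G) (all_plus G)"
  let ?H = "hamiltonian J h G"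
  have "finite (configs G)"
    unfolding configs_def using fin by (intro finite_PiE) auto
  moreover have "(\<lambda>\<gamma>. Max (?H ` set \<gamma>)) ` ?P \<subseteq> ?H ` configs G"
  proof
    fix y assume "y \<in> (\<lambda>\<gamma>. Max (?H ` set \<gamma>)) ` ?P"
    then obtain \<gamma> where \<gamma>: "\<gamma> \<in> ?P" "y = Max (?H ` set \<gamma>)" by blast
    then have "y \<in> ?H ` set \<gamma>" by (auto simp: paths_def intro!: Max_in)
    then show "y \<in> ?H ` configs G" using \<gamma>(1) by (auto simp: paths_def)
  qed
  ultimately have "finite ((\<lambda>\<gamma>. Max (?H ` set \<gamma>)) ` ?P)"
    by (meson finite_imageI finite_subset)
  moreover have "X + ?H (all_minus G) \<le> Max (?H ` set \<gamma>)" if \<gamma>: "\<gamma> \<in> ?P" for \<gamma>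
  proof -
    obtain \<sigma> where \<sigma>: "\<sigma> \<in> set \<gamma>" "X \<le> ?H \<sigma> - ?H (all_minus G)"
      using path[OF \<gamma>] by blast
    then have "?H \<sigma> \<le> Max (?H ` set \<gamma>)" by (intro Max_ge) auto
    then show ?thesis using \<sigma> by linarith
  qed
  ultimately have "X + ?H (all_minus G) \<le> comm_height J h G (all_minus G) (all_plus G)"
    unfolding comm_height_def using paths_minus_plus_nonempty[OF fin] by simp
  then show ?thesis unfolding energy_barrier_def by simp
qed

text \<open>Induction on the list: remove the head \<open>x\<close> from \<open>N\<close> if it occurs
  there, and otherwise any element, which is at least \<open>x\<close>.\<close>

lemma sum_take_sorted_le:
  fixes xs :: "nat list"
  assumes "sorted xs" and "N \<subseteq># mset xs"
  shows "sum_list (take (size N) xs) \<le> sum_mset N"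
  using assms
proof (induction xs arbitrary: N)
  case Nil
  then show ?case by simp
next
  case (Cons x xs)
  show ?case
  proof (cases "N = {#}")
    case True
    then show ?thesis by simp
  next
    case False
    have "\<exists>y. y \<in># N \<and> x \<le> y \<and> N - {#y#} \<subseteq># mset xs"
    proof (cases "x \<in># N")
      case True
      then show ?thesis using Cons.prems(2) by (auto intro!: exI[of _ x] simp: subset_eq_diff_conv)
    next
      case x: False
      then have sub: "N \<subseteq># mset xs"
        using Cons.prems(2) by (metis mset.simps(2) subset_mset.inf.absorb_iff2 inter_add_left1)
      obtain y where y: "y \<in># N" using False by blast
      then have "y \<in> set xs" using mset_subset_eqD[OF sub] by simp
      then have "x \<le> y" using Cons.prems(1) by simp
      moreover have "N - {#y#} \<subseteq># mset xs"
        using sub by (meson diff_subset_eq_self subset_mset.order_trans)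
      ultimately show ?thesis using y by blast
    qed
    then obtain y N' where y: "x \<le> y" "N = add_mset y N'" "N' \<subseteq># mset xs"
      by (metis insert_DiffM)
    have "sum_list (take (size N') xs) \<le> sum_mset N'"
      using Cons.IH[OF _ y(3)] Cons.prems(1) by simp
    then show ?thesis using y by simp
  qed
qed

lemma ell_card_le:
  assumes "finite (verts G)" and "A \<subseteq> verts G"
  shows "ell G (card A) \<le> (\<Sum>v\<in>A. vdegree G v)"
proof -
  let ?N = "image_mset (vdegree G) (mset_set A)"
  have "?N \<subseteq># mset (sorted_degrees G)"
    using assms unfolding sorted_degrees_def
    by (simp add: image_mset_subseteq_mono subset_imp_msubset_mset_set)
  moreover have "sorted (sorted_degrees G)" by (simp add: sorted_degrees_def)
  ultimately show ?thesis
    using sum_take_sorted_le[of "sorted_degrees G" ?N]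
    by (simp add: ell_def sum_unfold_sum_mset)
qed

lemma ell_card_verts:
  assumes "finite (verts G)"
  shows "ell G (card (verts G)) = (\<Sum>v\<in>verts G. vdegree G v)"
proof -
  have "length (sorted_degrees G) = card (verts G)"
    unfolding sorted_degrees_def
    by (metis mset_sorted_list_of_multiset size_image_mset size_mset size_mset_set)
  then have "ell G (card (verts G)) = sum_list (sorted_degrees G)"
    by (simp add: ell_def)
  also have "\<dots> = (\<Sum>v\<in>verts G. vdegree G v)"
    unfolding sorted_degrees_def
    by (metis mset_sorted_list_of_multiset sum_mset_sum_list sum_unfold_sum_mset)
  finally show ?thesis .
qed

lemma ell_mono: "k \<le> m \<Longrightarrow> ell G k \<le> ell G m"
proof -
  assume "k \<le> m"
  then have "take m (sorted_degrees G) = take k (sorted_degrees G) @ drop k (take m (sorted_degrees G))"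
    by (metis append_take_drop_id min.absorb1 take_take)
  then show "ell G k \<le> ell G m"
    unfolding ell_def by (metis le_add1 sum_list_append)
qed

text \<open>If \<open>A\<close> had more vertices than \<open>m_tilde G\<close>, its volume would be at
  least the sum of the \<open>m_tilde G\<close> smallest degrees, and so at least one half of the
  total.\<close>

lemma card_le_m_tilde:
  assumes fin: "finite (verts G)" and A: "A \<subseteq> verts G"
    and less: "2 * (\<Sum>v\<in>A. vdegree G v) < (\<Sum>v\<in>verts G. vdegree G v)"
  shows "card A \<le> m_tilde G"
proof (rule ccontr)
  let ?Q = "\<lambda>m. 1 \<le> m \<and> m \<le> card (verts G) \<and>
      real (ell G m) \<ge> 1/2 * real (ell G (card (verts G)))"
  assume "\<not> card A \<le> m_tilde G"
  then have "ell G (m_tilde G) \<le> ell G (card A)" by (intro ell_mono) simp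
  also have "\<dots> \<le> (\<Sum>v\<in>A. vdegree G v)" by (rule ell_card_le[OF fin A])
  finally have "2 * ell G (m_tilde G) < ell G (card (verts G))"
    using less ell_card_verts[OF fin] by linarith
  moreover have "?Q (card (verts G))"
    using less fin by (auto simp: Suc_le_eq card_gt_0_iff)
  then have "?Q (m_tilde G)" unfolding m_tilde_def by (rule LeastI)
  ultimately show False by linarith
qed

lemma exists_crossing_move:
  assumes "successively R xs" and "xs \<noteq> []" and "Q (hd xs)" and "\<not> Q (last xs)"
  shows "\<exists>x\<in>set xs. \<exists>y\<in>set xs. R x y \<and> Q x \<and> \<not> Q y"
  using assms
proof (induction xs)
  case Nil
  then show ?case by simp
next
  case (Cons x xs)
  show ?case
  proof (cases "xs = []")
    case True
    then show ?thesis using Cons.prems by simp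
  next
    case False
    then have "successively R xs" "R x (hd xs)"
      using Cons.prems(1) by (auto simp: successively_Cons)
    then show ?thesis
      using Cons.IH Cons.prems False by (cases "Q (hd xs)") auto
  qed
qed

text \<open>The isoperimetric criterion: it suffices to bound from below the cuts of those vertex sets
  whose volume is less than one half of the total, but by no more than a bound \<open>b\<close> on the
  degrees. The witness on a path is a configuration whose next move lifts the volume of the plus spins to
  at least one half.\<close>

lemma energy_barrier_matching_graph_ge:
  fixes X J h :: real
  assumes M: "M \<in> perfect_matchings (stubs n D)"
    and pos: "0 < (\<Sum>v=1..n. D v)" and J: "0 \<le> J" and h: "0 \<le> h"
    and b: "\<And>v. v \<in> {1..n} \<Longrightarrow> real (D v) \<le> b"
    and expand: "\<And>A. A \<subseteq> {1..n} \<Longrightarrow> 2 * (\<Sum>v\<in>A. D v) < (\<Sum>v=1..n. D v) \<Longrightarrow>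
      real (\<Sum>v=1..n. D v) \<le> 2 * (real (\<Sum>v\<in>A. D v) + b) \<Longrightarrow>
      X \<le> crossing M {s \<in> stubs n D. fst s \<in> A}"
  shows "J * X - h * m_tilde (matching_graph n M) \<le> energy_barrier J h (matching_graph n M)"
proof (rule energy_barrier_ge)
  let ?G = "matching_graph n M"
  let ?L = "\<Sum>v=1..n. D v"
  define plus :: "(nat \<Rightarrow> real) \<Rightarrow> nat set" where "plus \<sigma> = {v \<in> {1..n}. \<sigma> v = 1}" for \<sigma>
  define vol where "vol A = (\<Sum>v\<in>A. D v)" for A
  let ?low = "\<lambda>\<sigma>. 2 * vol (plus \<sigma>) < ?L"
  have plus_sub: "plus \<sigma> \<subseteq> {1..n}" for \<sigma> by (auto simp: plus_def)
  show "finite (verts ?G)" by simp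
  fix \<gamma> assume \<gamma>: "\<gamma> \<in> paths ?G (all_minus ?G) (all_plus ?G)"
  have "plus (all_minus ?G) = {}" by (auto simp: all_minus_def plus_def)
  then have low_minus: "?low (all_minus ?G)" using pos by (simp add: vol_def)
  have "plus (all_plus ?G) = {1..n}" by (auto simp: all_plus_def plus_def)
  then have high_plus: "\<not> ?low (all_plus ?G)" by (simp add: vol_def)
  have path: "successively (allowed_move ?G) \<gamma>" "\<gamma> \<noteq> []"
      "hd \<gamma> = all_minus ?G" "last \<gamma> = all_plus ?G"
    using \<gamma> by (simp_all add: paths_def)
  obtain \<sigma> \<tau> where \<sigma>: "\<sigma> \<in> set \<gamma>" "?low \<sigma>" and \<tau>: "\<not> ?low \<tau>"
    and move: "allowed_move ?G \<sigma> \<tau>"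
    using exists_crossing_move[where Q = ?low, OF path(1,2)] low_minus high_plus
    unfolding path(3,4) by blast
  let ?A = "plus \<sigma>"
  \<comment> \<open>The only flipped vertex accounts for the jump of the volume past one half.\<close>
  obtain v where v: "v \<in> {1..n}" "\<And>w. w \<in> {1..n} \<Longrightarrow> \<sigma> w \<noteq> \<tau> w \<Longrightarrow> w = v"
    using move unfolding allowed_move_def by (metis verts_matching_graph)
  have finA: "finite ?A" using plus_sub finite_subset by blast
  have "plus \<tau> \<subseteq> insert v ?A"
    using v(2) by (force simp: plus_def)
  then have "vol (plus \<tau>) \<le> vol (insert v ?A)"
    unfolding vol_def using finA by (intro sum_mono2) auto
  also have "\<dots> \<le> vol ?A + D v"
    unfolding vol_def using finA by (simp add: sum.insert_if)
  finally have "vol (plus \<tau>) \<le> vol ?A + D v" .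
  then have "2 * vol (plus \<tau>) \<le> 2 * (vol ?A + D v)" by (rule mult_left_mono) simp
  with \<tau> have "?L \<le> 2 * (vol ?A + D v)" by (meson le_trans not_le)
  then have "real ?L \<le> real (2 * (vol ?A + D v))" by (rule of_nat_mono)
  also have "\<dots> \<le> 2 * (real (vol ?A) + b)" using b[OF v(1)] by simp
  finally have "X \<le> crossing M {s \<in> stubs n D. fst s \<in> ?A}"
    using expand[OF plus_sub[of \<sigma>]] \<sigma>(2) unfolding vol_def by blast
  then have "J * X \<le> J * crossing M {s \<in> stubs n D. fst s \<in> ?A}"
    using J by (rule mult_left_mono)
  moreover have "card ?A \<le> m_tilde ?G"
  proof (rule card_le_m_tilde)
    have vol: "(\<Sum>v\<in>B. vdegree ?G v) = vol B" if "B \<subseteq> {1..n}" for B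
      unfolding vol_def using that vdegree_matching_graph[OF M] by (intro sum.cong) auto
    show "2 * (\<Sum>v\<in>?A. vdegree ?G v) < (\<Sum>v\<in>verts ?G. vdegree ?G v)"
      using \<sigma>(2) vol[of "{1..n}"] vol[OF plus_sub[of \<sigma>]]
      by (simp only: verts_matching_graph subset_refl) (simp add: vol_def)
  qed (use plus_sub in simp_all)
  then have "h * card ?A \<le> h * m_tilde ?G"
    using h by (intro mult_left_mono) auto
  moreover have "hamiltonian J h ?G \<sigma> - hamiltonian J h ?G (all_minus ?G) =
      J * crossing M {s \<in> stubs n D. fst s \<in> ?A} - h * card ?A"
    unfolding plus_def using move hamiltonian_matching_graph[OF M]
    by (simp only: allowed_move_def)
  ultimately have "J * X - h * m_tilde ?G \<le>
      hamiltonian J h ?G \<sigma> - hamiltonian J h ?G (all_minus ?G)"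
    by linarith
  then show "\<exists>\<sigma>\<in>set \<gamma>. J * X - h * m_tilde ?G \<le>
      hamiltonian J h ?G \<sigma> - hamiltonian J h ?G (all_minus ?G)"
    using \<sigma>(1) by blast
qed

section \<open>The union bound over vertex sets\<close>

text \<open>Subadditivity over the at most \<open>2 ^ n\<close> vertex sets that can occur in the
  isoperimetric criterion.\<close>

lemma prob_small_energy_barrier_le:
  fixes z b Y J h :: real
  assumes sum: "(\<Sum>v=1..n. D v) = 2 * r" and r: "0 < r"
    and b: "\<And>v. v \<in> {1..n} \<Longrightarrow> real (D v) \<le> b"
    and J: "0 \<le> J" and h: "0 \<le> h" and z: "0 < z" "z \<le> 1"
  shows "measure_pmf.prob (map_pmf (matching_graph n) (pmf_of_set (perfect_matchings (stubs n D))))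
      {G. energy_barrier J h G < J * Y - h * m_tilde G}
    \<le> 2 ^ n * (2 * real r * ((1 + z) / 2) ^ r * z powr - (Y + b))"
proof -
  let ?S = "stubs n D"
  let ?P = "pmf_of_set (perfect_matchings ?S)"
  let ?B = "2 * real r * ((1 + z) / 2) ^ r * z powr - (Y + b)"
  let ?T = "\<lambda>A. {s \<in> ?S. fst s \<in> A}"
  let ?E = "\<lambda>A. {M. real (crossing M (?T A)) < Y}"
  define \<A> where "\<A> = {A. A \<subseteq> {1..n} \<and> 2 * (\<Sum>v\<in>A. D v) < 2 * r \<and>
      real (2 * r) \<le> 2 * (real (\<Sum>v\<in>A. D v) + b)}"
  have S: "finite ?S" "card ?S = 2 * r"
    using stubs_finite card_stubs sum by auto
  have supp: "set_pmf ?P = perfect_matchings ?S"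
    by (rule set_pmf_of_perfect_matchings[OF S])
  have finA: "finite \<A>" and cardA: "card \<A> \<le> 2 ^ n"
  proof -
    have "\<A> \<subseteq> Pow {1..n}" by (auto simp: \<A>_def)
    then show "finite \<A>" by (rule finite_subset) simp
    from \<open>\<A> \<subseteq> Pow {1..n}\<close> have "card \<A> \<le> card (Pow {1..n})" by (intro card_mono) auto
    then show "card \<A> \<le> 2 ^ n" by (simp add: card_Pow)
  qed
  have "M \<in> (\<Union>A\<in>\<A>. ?E A)"
    if M: "M \<in> perfect_matchings ?S"
      and less: "energy_barrier J h (matching_graph n M) < J * Y - h * m_tilde (matching_graph n M)" for M
  proof (rule ccontr)
    assume "M \<notin> (\<Union>A\<in>\<A>. ?E A)"
    then have expand: "Y \<le> crossing M (?T A)" if "A \<in> \<A>" for A using that by force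
    have "J * Y - h * m_tilde (matching_graph n M) \<le> energy_barrier J h (matching_graph n M)"
    proof (rule energy_barrier_matching_graph_ge[OF M _ J h b])
      show "0 < (\<Sum>v=1..n. D v)" unfolding sum using r by simp
      show "Y \<le> crossing M (?T A)" if "A \<subseteq> {1..n}" "2 * (\<Sum>v\<in>A. D v) < (\<Sum>v=1..n. D v)"
        "real (\<Sum>v=1..n. D v) \<le> 2 * (real (\<Sum>v\<in>A. D v) + b)" for A
        using that expand unfolding sum \<A>_def by blast
    qed
    then show False using less by linarith
  qed
  then have "measure_pmf.prob ?P (matching_graph n -` {G. energy_barrier J h G < J * Y - h * m_tilde G})
      \<le> measure_pmf.prob ?P (\<Union>A\<in>\<A>. ?E A)"
    by (intro measure_pmf.finite_measure_mono_AE) (auto simp: AE_measure_pmf_iff supp)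
  also have "\<dots> \<le> (\<Sum>A\<in>\<A>. measure_pmf.prob ?P (?E A))"
    using finA by (intro measure_pmf.finite_measure_subadditive_finite) auto
  also have "\<dots> \<le> (\<Sum>A\<in>\<A>. ?B)"
  proof (intro sum_mono)
    fix A assume A: "A \<in> \<A>"
    then have card: "card (?T A) = (\<Sum>v\<in>A. D v)"
      using card_stubs_over[of A n D] by (simp add: \<A>_def)
    show "measure_pmf.prob ?P (?E A) \<le> ?B"
      using A S r z by (intro prob_crossing_near_half_le) (auto simp: \<A>_def card)
  qed
  also have "\<dots> = card \<A> * ?B" by simp
  also have "\<dots> \<le> 2 ^ n * ?B"
  proof (rule mult_right_mono)
    show "real (card \<A>) \<le> 2 ^ n" using cardA by (metis of_nat_le_iff of_nat_numeral of_nat_power)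
  qed (use z in simp)
  finally show ?thesis by simp
qed

section \<open>The rate function at one half\<close>

text \<open>All bases are positive for \<open>0 < y < 1/2\<close>, and the logarithm of the product is
  half the Shannon entropy of \<open>(2y, 1 - 2y)\<close> minus the constant \<open>(1/2 - 1/\<delta>) ln
  2\<close>.\<close>

lemma I_fun_half_product:
  assumes "0 < y" and "y < 1/2"
  shows "pow0 (1/2) (1/2 * (1 - 1/\<delta>)) * pow0 (1 - 1/2) ((1 - 1/2) * (1 - 1/\<delta>))
       * pow0 (1 - 1/2 - y) (- (1 - 1/2 - y) / 2) * pow0 (1/2 - y) (- (1/2 - y) / 2) * pow0 y (- y)
    = exp (- (1 - 1/\<delta>) * ln 2 - (1/2 - y) * ln (1/2 - y) - y * ln y)"
proof -
  have "ln (1/2) = - ln (2::real)" by (simp add: ln_div)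
  then show ?thesis
    using assms by (simp add: pow0_def powr_def exp_add[symmetric] field_simps)
qed

text \<open>The bound \<open>1/4\<close> comes from \<open>y = 1/4\<close>, the maximum of the entropy,
  where the product is \<open>2 powr (1/\<delta>)\<close>. It ensures that the optimal tilt \<open>z = y
  / (1/2 - y)\<close> below is less than \<open>1\<close>.\<close>

lemma I_fun_half_bounds:
  assumes \<delta>: "0 < \<delta>"
  shows "0 \<le> I_fun \<delta> (1/2)" and "I_fun \<delta> (1/2) \<le> 1/4"
    and "\<And>y. 0 < y \<Longrightarrow> y < I_fun \<delta> (1/2) \<Longrightarrow>
      - (1 - 1/\<delta>) * ln 2 - (1/2 - y) * ln (1/2 - y) - y * ln y \<le> 0"
proof -
  let ?P = "\<lambda>y. pow0 (1/2) (1/2 * (1 - 1/\<delta>)) * pow0 (1 - 1/2) ((1 - 1/2) * (1 - 1/\<delta>))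
       * pow0 (1 - 1/2 - y) (- (1 - 1/2 - y) / 2) * pow0 (1/2 - y) (- (1/2 - y) / 2) * pow0 y (- y)"
  let ?Y = "{y. 0 < y \<and> y \<le> 1/2 \<and> 1 < ?P y}"
  have I: "I_fun \<delta> (1/2) = Inf ?Y" by (simp only: I_fun_def)
  have bdd: "bdd_below ?Y" by (rule bdd_belowI[of _ 0]) simp
  have "ln (1/4) = - (2 * ln (2::real))"
    using ln_realpow[of 2 2] by (simp add: ln_div)
  then have "- (1 - 1/\<delta>) * ln 2 - (1/2 - 1/4) * ln (1/2 - 1/4) - 1/4 * ln (1/4) = ln 2 / \<delta>"
    by (simp add: field_simps)
  then have "?P (1/4) = exp (ln 2 / \<delta>)"
    using I_fun_half_product[of "1/4" \<delta>] by (simp only:)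
  then have quarter: "1/4 \<in> ?Y" using \<delta> by simp
  show "I_fun \<delta> (1/2) \<le> 1/4" unfolding I by (rule cInf_lower[OF quarter bdd])
  show "0 \<le> I_fun \<delta> (1/2)" unfolding I
    by (rule cInf_greatest) (use quarter in blast, simp)
  fix y assume y: "0 < y" "y < I_fun \<delta> (1/2)"
  then have "y < 1/4" using \<open>I_fun \<delta> (1/2) \<le> 1/4\<close> by linarith
  have "y \<notin> ?Y" using y(2) cInf_lower[OF _ bdd, of y] unfolding I by linarith
  then have "?P y \<le> 1" using y \<open>y < 1/4\<close> by auto
  then show "- (1 - 1/\<delta>) * ln 2 - (1/2 - y) * ln (1/2 - y) - y * ln y \<le> 0"
    using I_fun_half_product[of y \<delta>] y \<open>y < 1/4\<close> by simp
qed

text \<open>The quantity below is the base \<open>\<rho>\<close> of the bound \<open>2r \<rho>^r\<close>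
  on the probability of a small barrier, after \<open>n \<le> 2r / (\<delta> - \<eta>)\<close> has been
  inserted. Its logarithm \<open>F \<eta>\<close> is continuous at \<open>\<eta> = 0\<close>. For
  \<open>y\<close> half way between the threshold \<open>I - \<epsilon>/\<delta>\<close> and
  \<open>I\<close>, the value \<open>F 0\<close> is twice the logarithm of the product defining
  \<open>I\<close> at \<open>y\<close>, which is at most \<open>0\<close>, plus the negative term
  \<open>(\<epsilon>/\<delta>) ln z\<close> gained from the gap between the threshold and
  \<open>y\<close>.\<close>

lemma exists_contracting_parameters:
  assumes \<delta>: "0 < \<delta>" and \<epsilon>: "0 < \<epsilon>" and pos: "0 < \<delta> * I_fun \<delta> (1/2) - \<epsilon>"
  shows "\<exists>z \<eta>. 0 < z \<and> z < 1 \<and> 0 < \<eta> \<and> \<eta> < \<delta> \<and>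
    (1 + z) / 2 * (2 * z powr - (\<delta> * I_fun \<delta> (1/2) - \<epsilon> + \<eta>)) powr (2 / (\<delta> - \<eta>)) < 1"
proof -
  let ?I = "I_fun \<delta> (1/2)"
  define y where "y = ?I - \<epsilon> / (2 * \<delta>)"
  define z where "z = y / (1/2 - y)"
  define F where "F \<eta> = ln ((1 + z) / 2) + 2 / (\<delta> - \<eta>) * (ln 2 - (\<delta> * ?I - \<epsilon> + \<eta>) * ln z)" for \<eta>
  have "\<epsilon> / \<delta> < ?I" using pos \<delta> by (simp add: field_simps)
  moreover have "\<epsilon> / (2 * \<delta>) = (\<epsilon> / \<delta>) / 2" and "0 < \<epsilon> / \<delta>" using \<delta> \<epsilon> by auto
  ultimately have y: "0 < y" "y < ?I" unfolding y_def by linarith+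
  then have y4: "y < 1/4" using I_fun_half_bounds(2)[OF \<delta>] by linarith
  have z: "0 < z" "z < 1" using y y4 by (auto simp: z_def field_simps)
  have lnz: "ln z = ln y - ln (1/2 - y)" using y y4 by (simp add: z_def ln_div)
  have "(1 + z) / 2 = (1/4) / (1/2 - y)" using y4 by (simp add: z_def field_simps)
  then have "ln ((1 + z) / 2) = ln (1/4) - ln (1/2 - y)" using y4 by (simp only: ln_div) simp
  also have "ln (1/4) = - (2 * ln (2::real))"
    using ln_realpow[of 2 2] by (simp add: ln_div)
  finally have ln1z: "ln ((1 + z) / 2) = - 2 * ln 2 - ln (1/2 - y)" by simp
  have "F 0 = 2 * (- (1 - 1/\<delta>) * ln 2 - (1/2 - y) * ln (1/2 - y) - y * ln y) + \<epsilon> / \<delta> * ln z"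
    unfolding F_def ln1z lnz using \<delta> by (simp add: y_def field_simps)
  also have "\<dots> < 0"
    using I_fun_half_bounds(3)[OF \<delta> y] \<open>0 < \<epsilon> / \<delta>\<close> z
    by (intro add_nonpos_neg mult_pos_neg) auto
  finally have "F 0 < 0" .
  moreover have "isCont F 0" unfolding F_def using \<delta> by (intro continuous_intros) auto
  then have "(F \<longlongrightarrow> F 0) (at_right 0)" by (simp add: isCont_def filterlim_at_split)
  ultimately have "eventually (\<lambda>\<eta>. F \<eta> < 0) (at_right 0)" by (rule order_tendstoD(2)[rotated])
  moreover have "eventually (\<lambda>\<eta>. \<eta> \<in> {0<..<\<delta>}) (at_right 0)"
    using \<delta> by (rule eventually_at_right_real)
  ultimately have "eventually (\<lambda>\<eta>. F \<eta> < 0 \<and> \<eta> \<in> {0<..<\<delta>}) (at_right 0)"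
    by eventually_elim simp
  then obtain \<eta> where \<eta>: "F \<eta> < 0" "0 < \<eta>" "\<eta> < \<delta>"
    using eventually_happens[of _ "at_right (0::real)"] by (auto simp: trivial_limit_at_right_real)
  let ?B = "2 * z powr - (\<delta> * ?I - \<epsilon> + \<eta>)"
  have "ln ?B = ln 2 - (\<delta> * ?I - \<epsilon> + \<eta>) * ln z"
    using z by (simp add: ln_mult ln_powr algebra_simps)
  then have "(1 + z) / 2 * ?B powr (2 / (\<delta> - \<eta>)) = exp (F \<eta>)"
    using z by (simp add: F_def powr_def exp_add)
  also have "\<dots> < 1" using \<eta> by simp
  finally show ?thesis using z \<eta> by blast
qed

section \<open>Degree sequences with a finite mean\<close>

lemma indep_vars_iid_degrees:
  "prob_space.indep_vars (iid_degrees f n) (\<lambda>_. borel) (\<lambda>i D. g (D i) :: real) {1..n}"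
  unfolding iid_degrees_def
  by (rule prob_space.indep_vars_compose2[OF measure_pmf.prob_space_axioms indep_vars_Pi_pmf]) auto

lemma map_iid_degrees: "i \<in> {1..n} \<Longrightarrow> map_pmf (\<lambda>D. D i) (iid_degrees f n) = f"
  by (simp add: iid_degrees_def Pi_pmf_component)

lemma expectation_iid_degrees:
  fixes g :: "nat \<Rightarrow> real"
  assumes "i \<in> {1..n}"
  shows "measure_pmf.expectation (iid_degrees f n) (\<lambda>D. g (D i)) = measure_pmf.expectation f g"
  using integral_map_pmf[of "\<lambda>D. D i" "iid_degrees f n" g] map_iid_degrees[OF assms, of f] by simp

lemma expectation_parity:
  "measure_pmf.expectation (iid_degrees f n) (\<lambda>D. (- 1) ^ (\<Sum>i=1..n. D i)) =
   measure_pmf.expectation f (\<lambda>k. (- 1 :: real) ^ k) ^ n"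
proof -
  have bounded: "integrable (measure_pmf p) (\<lambda>x. (- 1 :: real) ^ (e x))" for p :: "'a pmf" and e
    by (intro measure_pmf.integrable_const_bound[of _ 1]) (auto simp: power_abs)
  have "measure_pmf.expectation (iid_degrees f n) (\<lambda>D. (- 1) ^ (\<Sum>i=1..n. D i)) =
      measure_pmf.expectation (iid_degrees f n) (\<lambda>D. \<Prod>i=1..n. (- 1 :: real) ^ D i)"
    by (simp add: power_sum)
  also have "\<dots> = (\<Prod>i=1..n. measure_pmf.expectation (iid_degrees f n) (\<lambda>D. (- 1 :: real) ^ D i))"
    by (rule prob_space.indep_vars_lebesgue_integral[OF measure_pmf.prob_space_axioms])
       (use indep_vars_iid_degrees[of f n "\<lambda>k. (- 1) ^ k"] in \<open>auto intro: bounded\<close>)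
  also have "\<dots> = (\<Prod>i=1..n. measure_pmf.expectation f (\<lambda>k. (- 1 :: real) ^ k))"
    by (intro prod.cong refl expectation_iid_degrees)
  finally show ?thesis by simp
qed

lemma prob_even_total:
  "measure_pmf.prob (iid_degrees f n) (even_total n) =
   (1 + measure_pmf.expectation f (\<lambda>k. (- 1) ^ k) ^ n) / 2"
proof -
  let ?p = "iid_degrees f n"
  have "(- 1 :: real) ^ (\<Sum>i=1..n. D i) = 2 * indicat_real (even_total n) D - 1" for D
    by (auto simp: even_total_def indicator_def)
  then have "measure_pmf.expectation ?p (\<lambda>D. (- 1) ^ (\<Sum>i=1..n. D i)) =
      measure_pmf.expectation ?p (\<lambda>D. 2 * indicat_real (even_total n) D - 1)" by simp
  also have "\<dots> = 2 * measure_pmf.prob ?p (even_total n) - 1"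
    by (subst Bochner_Integration.integral_diff) (auto simp: measure_pmf.prob_space measure_pmf.integrable_const_bound[of _ 1])
  finally show ?thesis unfolding expectation_parity by simp
qed

text \<open>With \<open>q\<close> the mean of \<open>(-1)\<close> to the power of the degree, an even
  total has probability \<open>(1 + q^n)/2\<close>. This is bounded away from \<open>0\<close> unless
  \<open>q = -1\<close>, that is, unless all degrees are odd; then admissibility forces \<open>n\<close>
  to be even and the probability is \<open>1\<close>.\<close>

lemma prob_even_total_bounded_below:
  "\<exists>c>0. \<forall>n\<in>admissible f. c \<le> measure_pmf.prob (iid_degrees f n) (even_total n)"
proof -
  define q where "q = measure_pmf.expectation f (\<lambda>k. (- 1 :: real) ^ k)"
  note prob = prob_even_total[of f, folded q_def]
  have q: "\<bar>q\<bar> \<le> 1"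
  proof -
    have "\<bar>q\<bar> \<le> measure_pmf.expectation f (\<lambda>k. \<bar>(- 1 :: real) ^ k\<bar>)"
      unfolding q_def by (rule integral_abs_bound)
    then show ?thesis by (simp add: power_abs measure_pmf.prob_space)
  qed
  show ?thesis
  proof (cases "q = - 1")
    case True
    have "1 \<le> measure_pmf.prob (iid_degrees f n) (even_total n)" if "n \<in> admissible f" for n
      using that by (cases "even n") (auto simp: admissible_def prob True)
    then show ?thesis by (intro exI[of _ 1]) auto
  next
    case False
    have "min (1/2) ((1 + q) / 2) \<le> measure_pmf.prob (iid_degrees f n) (even_total n)" for n
    proof -
      have "0 \<le> q ^ n \<or> q \<le> q ^ n"
      proof (cases "0 \<le> q \<or> n = 0")
        case False
        then have "\<bar>q\<bar> ^ n \<le> \<bar>q\<bar> ^ 1" using q by (intro power_decreasing) auto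
        then have "\<bar>q ^ n\<bar> \<le> \<bar>q\<bar>" by (simp add: power_abs)
        then show ?thesis using False by linarith
      qed auto
      then show ?thesis unfolding prob min_le_iff_disj by (elim disjE) (simp_all add: divide_right_mono)
    qed
    moreover have "0 < min (1/2) ((1 + q) / 2)" using False q by auto
    ultimately show ?thesis by blast
  qed
qed

context
  fixes f :: "nat pmf"
  assumes summable: "summable (\<lambda>k. real k * pmf f k)"
begin

lemma integrable_degree: "integrable (measure_pmf f) real"
  using summable unfolding measure_pmf_eq_density
  by (simp add: integrable_density integrable_count_space_nat_iff mult.commute)

text \<open>Up to the factor \<open>\<eta>\<close>, the tail probability times \<open>n\<close> is at
  most the mean of the degree restricted to the tail, which vanishes by dominated convergence.\<close>

lemma tendsto_n_times_tail_prob: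
  assumes \<eta>: "0 < \<eta>"
  shows "(\<lambda>n. real n * measure_pmf.prob f {k. \<eta> * real n < real k}) \<longlonglongrightarrow> 0"
proof -
  let ?A = "\<lambda>n. {k. \<eta> * real n < real k}"
  let ?E = "\<lambda>n. measure_pmf.expectation f (\<lambda>k. real k * indicator (?A n) k)"
  have "?E \<longlonglongrightarrow> measure_pmf.expectation f (\<lambda>k. 0)"
  proof (rule integral_dominated_convergence[where w = real])
    show "AE k in measure_pmf f. (\<lambda>n. real k * indicator (?A n) k) \<longlonglongrightarrow> 0"
    proof (rule AE_pmfI)
      fix k
      have "eventually (\<lambda>n. real k * indicator (?A n) k = 0) sequentially"
        using eventually_ge_at_top[of "nat \<lceil>real k / \<eta>\<rceil>"]
      proof eventually_elim
        case (elim n)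
        then have "real k / \<eta> \<le> real n" by linarith
        then show ?case using \<eta> by (simp add: field_simps)
      qed
      then show "(\<lambda>n. real k * indicator (?A n) k) \<longlonglongrightarrow> 0" by (rule tendsto_eventually)
    qed
  qed (auto intro: integrable_degree simp: indicator_def)
  then have lim: "(\<lambda>n. ?E n / \<eta>) \<longlonglongrightarrow> 0"
    using tendsto_divide[of ?E 0 sequentially "\<lambda>_. \<eta>" \<eta>] \<eta> by simp
  have "real n * measure_pmf.prob f (?A n) \<le> ?E n / \<eta>" for n
  proof -
    have "measure_pmf.expectation f (\<lambda>k. \<eta> * real n * indicator (?A n) k) \<le> ?E n"
    proof (rule integral_mono)
      show "integrable (measure_pmf f) (\<lambda>k. real k * indicator (?A n) k)"
        by (rule Bochner_Integration.integrable_bound[OF integrable_degree]) (auto simp: indicator_def)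
      show "integrable (measure_pmf f) (\<lambda>k. \<eta> * real n * indicator (?A n) k)"
        by (intro integrable_mult_right measure_pmf.integrable_const_bound[of _ 1]) auto
    qed (auto simp: indicator_def)
    then show ?thesis using \<eta> by (simp add: field_simps)
  qed
  then show ?thesis
    by (intro tendsto_sandwich[OF _ _ tendsto_const lim] always_eventually allI) auto
qed

lemma tendsto_prob_large_degree:
  assumes "0 < \<eta>"
  shows "(\<lambda>n. measure_pmf.prob (iid_degrees f n) {D. \<exists>i\<in>{1..n}. \<eta> * real n < real (D i)}) \<longlonglongrightarrow> 0"
proof (rule tendsto_sandwich[OF _ _ tendsto_const tendsto_n_times_tail_prob[OF assms]])
  have "measure_pmf.prob (iid_degrees f n) {D. \<exists>i\<in>{1..n}. \<eta> * real n < real (D i)}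
      \<le> real n * measure_pmf.prob f {k. \<eta> * real n < real k}" for n
  proof -
    let ?A = "{k. \<eta> * real n < real k}"
    have "{D. \<exists>i\<in>{1..n}. \<eta> * real n < real (D i)} = (\<Union>i\<in>{1..n}. (\<lambda>D. D i) -` ?A)" by auto
    then have "measure_pmf.prob (iid_degrees f n) {D. \<exists>i\<in>{1..n}. \<eta> * real n < real (D i)}
        \<le> (\<Sum>i=1..n. measure_pmf.prob (iid_degrees f n) ((\<lambda>D. D i) -` ?A))"
      by (simp only:) (intro measure_pmf.finite_measure_subadditive_finite, auto)
    also have "\<dots> = (\<Sum>i=1..n. measure_pmf.prob f ?A)"
      by (intro sum.cong refl) (metis map_iid_degrees measure_map_pmf)
    finally show ?thesis by simp
  qed
  then show "\<forall>\<^sub>F n in sequentially.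
      measure_pmf.prob (iid_degrees f n) {D. \<exists>i\<in>{1..n}. \<eta> * real n < real (D i)}
      \<le> real n * measure_pmf.prob f {k. \<eta> * real n < real k}" by simp
qed simp

text \<open>The lower half of the weak law of large numbers. Replacing degrees of at least
  \<open>m\<close> by \<open>0\<close> does not increase the sum, lowers the mean by less than
  \<open>\<eta>/2\<close> if \<open>m\<close> is large, and makes the summands bounded, so that
  Hoeffding's inequality applies.\<close>

lemma tendsto_prob_small_total_degree:
  assumes \<eta>: "0 < \<eta>"
  shows "(\<lambda>n. measure_pmf.prob (iid_degrees f n)
    {D. real (\<Sum>i=1..n. D i) < (mean_degree f - \<eta>) * real n}) \<longlonglongrightarrow> 0"
proof -
  have "(\<lambda>m. \<Sum>k<m. real k * pmf f k) \<longlonglongrightarrow> mean_degree f"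
    unfolding mean_degree_def by (rule summable_LIMSEQ[OF summable])
  then have "\<forall>\<^sub>F m in sequentially. mean_degree f - \<eta> / 2 < (\<Sum>k<m. real k * pmf f k)"
    using \<eta> by (intro order_tendstoD(1)) auto
  then have "\<forall>\<^sub>F m in sequentially. mean_degree f - \<eta> / 2 < (\<Sum>k<m. real k * pmf f k) \<and> 0 < m"
    using eventually_gt_at_top[of 0] by eventually_elim simp
  then obtain m where m: "mean_degree f - \<eta> / 2 < (\<Sum>k<m. real k * pmf f k)" "0 < m"
    by (auto simp: eventually_sequentially)
  define g :: "nat \<Rightarrow> real" where "g k = (if k < m then real k else 0)" for k
  define \<mu> where "\<mu> = measure_pmf.expectation f g"
  have "\<mu> = (\<Sum>k<m. g k * pmf f k)"
    unfolding \<mu>_def by (rule integral_measure_pmf_real) (auto simp: g_def split: if_splits)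
  also have "\<dots> = (\<Sum>k<m. real k * pmf f k)" by (intro sum.cong) (auto simp: g_def)
  finally have \<mu>: "mean_degree f - \<eta> / 2 < \<mu>" using m by simp
  have bound: "measure_pmf.prob (iid_degrees f n) {D. real (\<Sum>i=1..n. D i) < (mean_degree f - \<eta>) * real n}
      \<le> exp (- (\<eta>\<^sup>2 / (2 * (real m)\<^sup>2)) * real n)" if n: "0 < n" for n
  proof -
    interpret Hoeffding_ineq "iid_degrees f n" "{1..n}" "\<lambda>i D. g (D i)" "\<lambda>_. 0" "\<lambda>_. real m" "real n * \<mu>"
    proof unfold_locales
      show "prob_space.indep_vars (iid_degrees f n) (\<lambda>_. borel) (\<lambda>i D. g (D i)) {1..n}"
        by (rule indep_vars_iid_degrees)
      show "real n * \<mu> \<equiv> \<Sum>i=1..n. measure_pmf.expectation (iid_degrees f n) (\<lambda>D. g (D i))"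
        by (rule eq_reflection) (simp add: expectation_iid_degrees \<mu>_def)
    qed (auto simp: g_def)
    have "{D. real (\<Sum>i=1..n. D i) < (mean_degree f - \<eta>) * real n}
        \<subseteq> {D. (\<Sum>i=1..n. g (D i)) \<le> real n * \<mu> - real n * (\<eta> / 2)}"
    proof safe
      fix D assume D: "real (\<Sum>i=1..n. D i) < (mean_degree f - \<eta>) * real n"
      have "(\<Sum>i=1..n. g (D i)) \<le> (\<Sum>i=1..n. real (D i))" by (intro sum_mono) (simp add: g_def)
      also have "\<dots> < (mean_degree f - \<eta>) * real n" using D by simp
      also have "\<dots> \<le> (\<mu> - \<eta> / 2) * real n" using \<mu> by (intro mult_right_mono) auto
      finally show "(\<Sum>i=1..n. g (D i)) \<le> real n * \<mu> - real n * (\<eta> / 2)" by (simp add: algebra_simps)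
    qed
    then have "measure_pmf.prob (iid_degrees f n) {D. real (\<Sum>i=1..n. D i) < (mean_degree f - \<eta>) * real n}
        \<le> measure_pmf.prob (iid_degrees f n) {D. (\<Sum>i=1..n. g (D i)) \<le> real n * \<mu> - real n * (\<eta> / 2)}"
      by (intro measure_pmf.finite_measure_mono) auto
    also have "\<dots> \<le> exp (- 2 * (real n * (\<eta> / 2))\<^sup>2 / (\<Sum>i=1..n. (real m - 0)\<^sup>2))"
      using Hoeffding_ineq_le[of "real n * (\<eta> / 2)"] \<eta> m n by simp
    also have "- 2 * (real n * (\<eta> / 2))\<^sup>2 / (\<Sum>i=1..n. (real m - 0)\<^sup>2) = - (\<eta>\<^sup>2 / (2 * (real m)\<^sup>2)) * real n"
      using n m by (simp add: power2_eq_square field_simps)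
    finally show ?thesis .
  qed
  have rate: "0 < \<eta>\<^sup>2 / (2 * (real m)\<^sup>2)" using \<eta> m by simp
  have "filterlim (\<lambda>n. - (\<eta>\<^sup>2 / (2 * (real m)\<^sup>2)) * real n) at_bot sequentially"
    by (rule filterlim_tendsto_neg_mult_at_bot[OF tendsto_const _ filterlim_real_sequentially])
       (use rate in linarith)
  then have "(\<lambda>n. exp (- (\<eta>\<^sup>2 / (2 * (real m)\<^sup>2)) * real n)) \<longlonglongrightarrow> 0"
    by (rule filterlim_compose[OF exp_at_bot])
  then show ?thesis
  proof (rule tendsto_sandwich[OF _ _ tendsto_const, rotated 2])
    show "\<forall>\<^sub>F n in sequentially. measure_pmf.prob (iid_degrees f n)
        {D. real (\<Sum>i=1..n. D i) < (mean_degree f - \<eta>) * real n}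
        \<le> exp (- (\<eta>\<^sup>2 / (2 * (real m)\<^sup>2)) * real n)"
      using eventually_gt_at_top[of 0] by eventually_elim (rule bound)
  qed simp
qed

end

lemma prob_cond_pmf_le:
  assumes "set_pmf p \<inter> S \<noteq> {}"
  shows "measure_pmf.prob (cond_pmf p S) B \<le> measure_pmf.prob p B / measure_pmf.prob p S"
proof -
  have "measure_pmf.prob (cond_pmf p S) B = measure_pmf.prob p (S \<inter> B) / measure_pmf.prob p S"
    using assms by (simp add: cond_pmf.rep_eq measure_uniform_measure emeasure_measure_pmf_not_zero)
  also have "\<dots> \<le> measure_pmf.prob p B / measure_pmf.prob p S"
    by (intro divide_right_mono measure_pmf.finite_measure_mono) auto
  finally show ?thesis .
qed

lemma prob_bind_pmf_le:
  assumes c: "0 \<le> c" and F: "\<And>x. x \<in> set_pmf p \<Longrightarrow> x \<notin> B \<Longrightarrow> measure_pmf.prob (F x) E \<le> c"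
  shows "measure_pmf.prob (bind_pmf p F) E \<le> measure_pmf.prob p B + c"
proof -
  have "emeasure (bind_pmf p F) E = (\<integral>\<^sup>+ x. emeasure (F x) E \<partial>p)" by simp
  also have "\<dots> \<le> (\<integral>\<^sup>+ x. indicator B x + ennreal c \<partial>p)"
  proof (intro nn_integral_mono_AE AE_pmfI)
    fix x assume x: "x \<in> set_pmf p"
    show "emeasure (F x) E \<le> indicator B x + ennreal c"
    proof (cases "x \<in> B")
      case True
      have "emeasure (F x) E \<le> 1" by (rule measure_pmf.emeasure_le_1)
      also have "\<dots> \<le> indicator B x + ennreal c" using True by simp
      finally show ?thesis .
    next
      case False
      then show ?thesis using F[OF x] c by (simp add: measure_pmf.emeasure_eq_measure ennreal_leI)
    qed
  qed
  also have "\<dots> = emeasure p B + ennreal c"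
    by (subst nn_integral_add) (auto simp: measure_pmf.emeasure_space_1)
  finally have "ennreal (measure_pmf.prob (bind_pmf p F) E) \<le> ennreal (measure_pmf.prob p B + c)"
    using c by (simp add: measure_pmf.emeasure_eq_measure ennreal_plus del: emeasure_bind_pmf)
  then show ?thesis using c by (subst (asm) ennreal_le_iff) auto
qed

section \<open>The energy barrier of the configuration model\<close>

text \<open>Transfers a bound that is uniform over typical even degree sequences to the configuration
  model. Atypical sequences have vanishing probability for independent degrees, and conditioning on an
  even total multiplies it by at most a bounded factor.\<close>

lemma tendsto_config_model:
  assumes summable: "summable (\<lambda>k. real k * pmf f k)" and \<eta>: "0 < \<eta>"
    and typical: "\<And>c. 0 < c \<Longrightarrow> \<forall>\<^sub>F n in sequentially. \<forall>D. even (\<Sum>i=1..n. D i) \<longrightarrow>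
      (mean_degree f - \<eta>) * real n \<le> real (\<Sum>i=1..n. D i) \<longrightarrow> (\<forall>i\<in>{1..n}. real (D i) \<le> \<eta> * real n) \<longrightarrow>
      measure_pmf.prob (map_pmf (matching_graph n) (pmf_of_set (perfect_matchings (stubs n D)))) (E n) \<le> c"
  shows "((\<lambda>n. measure_pmf.prob (config_model f n) (E n)) \<longlongrightarrow> 0)
    (inf sequentially (principal (admissible f)))"
proof (rule tendstoI)
  fix e :: real assume e: "0 < e"
  let ?small = "\<lambda>n. {D. real (\<Sum>i=1..n. D i) < (mean_degree f - \<eta>) * real n}"
  let ?large = "\<lambda>n. {D. \<exists>i\<in>{1..n}. \<eta> * real n < real (D i)}"
  let ?p = "iid_degrees f"
  obtain c where c: "0 < c" "\<And>n. n \<in> admissible f \<Longrightarrow> c \<le> measure_pmf.prob (?p n) (even_total n)"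
    using prob_even_total_bounded_below by blast
  have "(\<lambda>n. (measure_pmf.prob (?p n) (?small n) + measure_pmf.prob (?p n) (?large n)) / c) \<longlonglongrightarrow> 0"
    using tendsto_divide[OF tendsto_add[OF tendsto_prob_small_total_degree[OF summable \<eta>]
        tendsto_prob_large_degree[OF summable \<eta>]] tendsto_const[of c]] c by simp
  then have "\<forall>\<^sub>F n in sequentially.
      (measure_pmf.prob (?p n) (?small n) + measure_pmf.prob (?p n) (?large n)) / c < e / 2"
    using e by (intro order_tendstoD(2)) auto
  moreover have "0 < e / 2" using e by simp
  note typical[OF this]
  ultimately have "\<forall>\<^sub>F n in sequentially. n \<in> admissible f \<longrightarrow>
      measure_pmf.prob (config_model f n) (E n) < e"
  proof eventually_elim
    case (elim n)
    show ?case
    proof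
      assume n: "n \<in> admissible f"
      let ?q = "cond_pmf (?p n) (even_total n)"
      let ?bad = "?small n \<union> ?large n"
      have "0 < measure_pmf.prob (?p n) (even_total n)" using n by (simp add: admissible_def)
      then have ne: "set_pmf (?p n) \<inter> even_total n \<noteq> {}"
        by (metis less_irrefl measure_pmf_zero_iff)
      have "measure_pmf.prob (config_model f n) (E n) \<le> measure_pmf.prob ?q ?bad + e / 2"
        unfolding config_model_def
      proof (rule prob_bind_pmf_le)
        fix D assume D: "D \<in> set_pmf ?q" "D \<notin> ?bad"
        have "even (\<Sum>i=1..n. D i)" using D(1) ne by (simp add: even_total_def)
        moreover have "(mean_degree f - \<eta>) * real n \<le> real (\<Sum>i=1..n. D i)"
          and "\<forall>i\<in>{1..n}. real (D i) \<le> \<eta> * real n" using D(2) by force+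
        ultimately show "measure_pmf.prob
            (map_pmf (matching_graph n) (pmf_of_set (perfect_matchings (stubs n D)))) (E n) \<le> e / 2"
          using elim(2) by blast
      qed (use e in simp)
      also have "measure_pmf.prob ?q ?bad \<le> measure_pmf.prob (?p n) ?bad / measure_pmf.prob (?p n) (even_total n)"
        by (rule prob_cond_pmf_le[OF ne])
      also have "\<dots> \<le> measure_pmf.prob (?p n) ?bad / c"
        using c n by (intro divide_left_mono mult_pos_pos) (auto intro: less_le_trans)
      also have "\<dots> \<le> (measure_pmf.prob (?p n) (?small n) + measure_pmf.prob (?p n) (?large n)) / c"
        using c by (intro divide_right_mono measure_Un_le) auto
      finally show "measure_pmf.prob (config_model f n) (E n) < e" using elim(1) by linarith
    qed
  qed
  then show "\<forall>\<^sub>F n in inf sequentially (principal (admissible f)).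
      dist (measure_pmf.prob (config_model f n) (E n)) 0 < e"
    by (simp add: eventually_inf_principal)
qed

text \<open>If \<open>\<delta> I - \<epsilon> > 0\<close>, the union bound with contracting parameters is
  at most \<open>2r \<rho>^r\<close>, which vanishes because \<open>r\<close> grows at least linearly in
  \<open>n\<close> for typical degrees. Otherwise the number of cut pairs is trivially at least the
  claimed one.\<close>

lemma tendsto_prob_small_energy_barrier:
  fixes J h \<epsilon> :: real
  assumes J: "0 \<le> J" and h: "0 \<le> h" and summable: "summable (\<lambda>k. real k * pmf f k)"
    and \<delta>: "\<delta> = mean_degree f" "0 < \<delta>" and \<epsilon>: "0 < \<epsilon>"
  shows "((\<lambda>n. measure_pmf.prob (config_model f n)
      {G. energy_barrier J h G < J * ((\<delta> * I_fun \<delta> (1/2) - \<epsilon>) * real n) - h * m_tilde G}) \<longlongrightarrow> 0)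
    (inf sequentially (principal (admissible f)))"
proof (cases "0 < \<delta> * I_fun \<delta> (1/2) - \<epsilon>")
  case True
  let ?y = "\<delta> * I_fun \<delta> (1/2) - \<epsilon>"
  obtain z \<eta> where z: "0 < z" "z < 1" and \<eta>: "0 < \<eta>" "\<eta> < \<delta>"
    and contr: "(1 + z) / 2 * (2 * z powr - (?y + \<eta>)) powr (2 / (\<delta> - \<eta>)) < 1"
    using exists_contracting_parameters[OF \<delta>(2) \<epsilon> True] by blast
  define B where "B = 2 * z powr - (?y + \<eta>)"
  define \<rho> where "\<rho> = (1 + z) / 2 * B powr (2 / (\<delta> - \<eta>))"
  have "1 \<le> z powr - (?y + \<eta>)"
    using z \<eta> True powr_mono'[of "- (?y + \<eta>)" 0 z] by simp
  then have B: "1 \<le> B" by (simp add: B_def)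
  have \<rho>: "0 \<le> \<rho>" "\<rho> < 1" using contr z by (auto simp: \<rho>_def B_def)
  show ?thesis
  proof (rule tendsto_config_model[OF summable \<eta>(1)])
    fix c :: real assume c: "0 < c"
    have "(\<lambda>r. 2 * (real r * \<rho> ^ r)) \<longlonglongrightarrow> 0"
      using \<rho> by (intro tendsto_mult_right_zero powser_times_n_limit_0) auto
    then have "\<forall>\<^sub>F r in sequentially. 2 * (real r * \<rho> ^ r) < c"
      using c by (rule order_tendstoD(2))
    then obtain R where R: "\<And>r. R \<le> r \<Longrightarrow> 2 * (real r * \<rho> ^ r) < c"
      by (auto simp: eventually_sequentially)
    show "\<forall>\<^sub>F n in sequentially. \<forall>D. even (\<Sum>i=1..n. D i) \<longrightarrow>
      (mean_degree f - \<eta>) * real n \<le> real (\<Sum>i=1..n. D i) \<longrightarrow> (\<forall>i\<in>{1..n}. real (D i) \<le> \<eta> * real n) \<longrightarrow>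
      measure_pmf.prob (map_pmf (matching_graph n) (pmf_of_set (perfect_matchings (stubs n D))))
        {G. energy_barrier J h G < J * (?y * real n) - h * m_tilde G} \<le> c"
      using eventually_ge_at_top[of "nat \<lceil>2 * real R / (\<delta> - \<eta>)\<rceil>"] eventually_gt_at_top[of 0]
    proof (eventually_elim, intro allI impI)
      fix n and D :: "nat \<Rightarrow> nat"
      assume "nat \<lceil>2 * real R / (\<delta> - \<eta>)\<rceil> \<le> n" and n: "0 < n"
        and ev: "even (\<Sum>i=1..n. D i)"
        and total: "(mean_degree f - \<eta>) * real n \<le> real (\<Sum>i=1..n. D i)"
        and large: "\<forall>i\<in>{1..n}. real (D i) \<le> \<eta> * real n"
      then have "2 * real R / (\<delta> - \<eta>) \<le> real n" by linarith
      then have R_le: "2 * real R \<le> (\<delta> - \<eta>) * real n" using \<eta> by (simp add: field_simps)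
      obtain r where r: "(\<Sum>i=1..n. D i) = 2 * r" using ev by blast
      have le_r: "(\<delta> - \<eta>) * real n \<le> 2 * real r" using total unfolding r \<delta>(1) by simp
      moreover have "0 < (\<delta> - \<eta>) * real n" using \<eta> n by simp
      ultimately have "0 < r" and "R \<le> r" using R_le by linarith+
      have "measure_pmf.prob (map_pmf (matching_graph n) (pmf_of_set (perfect_matchings (stubs n D))))
          {G. energy_barrier J h G < J * (?y * real n) - h * m_tilde G}
        \<le> 2 ^ n * (2 * real r * ((1 + z) / 2) ^ r * z powr - (?y * real n + \<eta> * real n))"
        using large z by (intro prob_small_energy_barrier_le[OF r \<open>0 < r\<close> _ J h]) auto
      also have "z powr - (?y * real n + \<eta> * real n) = (z powr - (?y + \<eta>)) ^ n"
        using z by (simp add: powr_realpow[symmetric] powr_powr algebra_simps)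
      also have "2 ^ n * (2 * real r * ((1 + z) / 2) ^ r * (z powr - (?y + \<eta>)) ^ n) =
          2 * real r * ((1 + z) / 2) ^ r * B ^ n"
        by (simp add: B_def power_mult_distrib)
      also have "B ^ n \<le> (B powr (2 / (\<delta> - \<eta>))) ^ r"
      proof -
        have "B ^ n = B powr real n" using B by (simp add: powr_realpow)
        also have "\<dots> \<le> B powr (2 / (\<delta> - \<eta>) * real r)"
          using B le_r \<eta> by (intro powr_mono) (auto simp: field_simps)
        also have "\<dots> = (B powr (2 / (\<delta> - \<eta>))) ^ r"
          using B by (simp add: powr_realpow[symmetric] powr_powr)
        finally show ?thesis .
      qed
      then have "2 * real r * ((1 + z) / 2) ^ r * B ^ n \<le> 2 * real r * ((1 + z) / 2) ^ r * (B powr (2 / (\<delta> - \<eta>))) ^ r"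
        using z by (intro mult_left_mono) auto
      also have "\<dots> = 2 * (real r * \<rho> ^ r)"
        unfolding \<rho>_def power_mult_distrib by (simp only: mult.assoc)
      also have "\<dots> \<le> c" using R[OF \<open>R \<le> r\<close>] by simp
      finally show "measure_pmf.prob (map_pmf (matching_graph n) (pmf_of_set (perfect_matchings (stubs n D))))
          {G. energy_barrier J h G < J * (?y * real n) - h * m_tilde G} \<le> c" .
    qed
  qed
next
  case False
  let ?y = "\<delta> * I_fun \<delta> (1/2) - \<epsilon>"
  have "0 < \<delta> / 2" using \<delta>(2) by simp
  then show ?thesis
  proof (rule tendsto_config_model[OF summable])
    fix c :: real assume c: "0 < c"
    show "\<forall>\<^sub>F n in sequentially. \<forall>D. even (\<Sum>i=1..n. D i) \<longrightarrow>
      (mean_degree f - \<delta> / 2) * real n \<le> real (\<Sum>i=1..n. D i) \<longrightarrow> (\<forall>i\<in>{1..n}. real (D i) \<le> \<delta> / 2 * real n) \<longrightarrow>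
      measure_pmf.prob (map_pmf (matching_graph n) (pmf_of_set (perfect_matchings (stubs n D))))
        {G. energy_barrier J h G < J * (?y * real n) - h * m_tilde G} \<le> c"
      using eventually_gt_at_top[of 0]
    proof (eventually_elim, intro allI impI)
      fix n and D :: "nat \<Rightarrow> nat"
      assume n: "0 < n" and ev: "even (\<Sum>i=1..n. D i)"
        and total: "(mean_degree f - \<delta> / 2) * real n \<le> real (\<Sum>i=1..n. D i)"
        and large: "\<forall>i\<in>{1..n}. real (D i) \<le> \<delta> / 2 * real n"
      let ?PM = "perfect_matchings (stubs n D)"
      obtain r where r: "(\<Sum>i=1..n. D i) = 2 * r" using ev by blast
      have "0 < \<delta> / 2 * real n" using \<delta>(2) n by simp
      then have "0 < real (\<Sum>i=1..n. D i)" using total unfolding \<delta>(1) by (simp add: algebra_simps)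
      then have pos: "0 < (\<Sum>i=1..n. D i)" by linarith
      have supp: "set_pmf (pmf_of_set ?PM) = ?PM"
        by (rule set_pmf_of_perfect_matchings[OF stubs_finite, of n D r]) (unfold card_stubs r, rule refl)
      \<comment> \<open>The claimed number of cut pairs is not positive, so every vertex set satisfies the isoperimetric criterion.\<close>
      have "?y * real n \<le> 0" using False by (intro mult_nonpos_nonneg) auto
      then have "?y * real n \<le> real k" for k by (rule order_trans) simp
      then have "J * (?y * real n) - h * m_tilde (matching_graph n M) \<le> energy_barrier J h (matching_graph n M)"
        if "M \<in> ?PM" for M
        using large
        by (intro energy_barrier_matching_graph_ge[OF that pos J h, where b = "\<delta> / 2 * real n"]) auto
      then have "measure_pmf.prob (pmf_of_set ?PM)
          (matching_graph n -` {G. energy_barrier J h G < J * (?y * real n) - h * m_tilde G}) = 0"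
        unfolding measure_pmf_zero_iff supp by (auto simp: not_le[symmetric])
      then show "measure_pmf.prob (map_pmf (matching_graph n) (pmf_of_set ?PM))
          {G. energy_barrier J h G < J * (?y * real n) - h * m_tilde G} \<le> c"
        using c by simp
    qed
  qed
qed

text \<open>For each \<open>n\<close> take the largest \<open>K \<le> n\<close> for which the error
  \<open>1/(K+1)\<close> already gives \<open>p\<close> an absolute value below \<open>1/(K+1)\<close>;
  each fixed \<open>k\<close> is eventually a candidate, so \<open>K\<close> tends to infinity.\<close>

lemma exists_null_sequence_diagonal:
  fixes p :: "real \<Rightarrow> nat \<Rightarrow> real"
  assumes lim: "\<And>\<epsilon>. 0 < \<epsilon> \<Longrightarrow> (p \<epsilon> \<longlongrightarrow> 0) (inf sequentially (principal A))"
  shows "\<exists>\<epsilon>. \<epsilon> \<longlonglongrightarrow> 0 \<and> ((\<lambda>n. p (\<epsilon> n) n) \<longlongrightarrow> 0) (inf sequentially (principal A))"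
proof -
  define r :: "nat \<Rightarrow> real" where "r k = inverse (real (Suc k))" for k
  define C where "C n = {k. k \<le> n \<and> (k = 0 \<or> n \<notin> A \<or> \<bar>p (r k) n\<bar> < r k)}" for n
  define K where "K n = Max (C n)" for n
  have fin: "finite (C n)" for n by (simp add: C_def)
  have "0 \<in> C n" for n by (simp add: C_def)
  then have K_in: "K n \<in> C n" for n unfolding K_def using Max_in[OF fin] by blast
  have K_top: "filterlim K at_top sequentially"
    unfolding filterlim_at_top
  proof
    fix k
    have "0 < r k" by (simp add: r_def)
    then have "\<forall>\<^sub>F n in inf sequentially (principal A). \<bar>p (r k) n\<bar> < r k"
      using tendstoD[OF lim, of "r k" "r k"] by (simp add: dist_real_def)
    then have "\<forall>\<^sub>F n in sequentially. n \<in> A \<longrightarrow> \<bar>p (r k) n\<bar> < r k"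
      by (simp add: eventually_inf_principal)
    then show "\<forall>\<^sub>F n in sequentially. k \<le> K n"
      using eventually_ge_at_top[of k]
    proof eventually_elim
      case (elim n)
      then have "k \<in> C n" by (auto simp: C_def)
      then show ?case unfolding K_def by (rule Max_ge[OF fin])
    qed
  qed
  have r_lim: "(\<lambda>n. r (K n)) \<longlonglongrightarrow> 0"
    unfolding r_def by (rule filterlim_compose[OF LIMSEQ_inverse_real_of_nat K_top])
  have "\<forall>\<^sub>F n in sequentially. 1 \<le> K n" using K_top unfolding filterlim_at_top by blast
  then have "\<forall>\<^sub>F n in sequentially. n \<in> A \<longrightarrow> norm (p (r (K n)) n) \<le> r (K n)"
  proof eventually_elim
    case (elim n)
    then show ?case using K_in[of n] by (auto simp: C_def)
  qed
  then have "\<forall>\<^sub>F n in inf sequentially (principal A). norm (p (r (K n)) n) \<le> r (K n)"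
    by (simp add: eventually_inf_principal)
  moreover have "((\<lambda>n. r (K n)) \<longlongrightarrow> 0) (inf sequentially (principal A))"
    using r_lim by (rule tendsto_mono[rotated]) simp
  ultimately have "((\<lambda>n. p (r (K n)) n) \<longlongrightarrow> 0) (inf sequentially (principal A))"
    by (rule Lim_null_comparison)
  then show ?thesis using r_lim by blast
qed

theorem theorem1p8:
  fixes J h :: real and f :: "nat pmf"
  assumes "J > 0" and "h > 0"
    and "pmf f 0 = 0"
    and "(LEAST k. pmf f k > 0) \<ge> 3"
    and "summable (\<lambda>k. real k * pmf f k)"
  shows "\<exists>\<epsilon> :: nat \<Rightarrow> real. \<epsilon> \<longlonglongrightarrow> 0 \<and>
    ((\<lambda>n. measure_pmf.prob (config_model f n)
        {G. energy_barrier J h G \<ge>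
              J * mean_degree f * I_fun (mean_degree f) (1/2) * real n
                - h * real (m_tilde G) - \<epsilon> n * real n})
      \<longlongrightarrow> 1) (inf sequentially (principal (admissible f)))"
proof -
  let ?\<delta> = "mean_degree f"
  let ?F = "inf sequentially (principal (admissible f))"
  let ?bound = "\<lambda>\<epsilon> n G. J * ?\<delta> * I_fun ?\<delta> (1/2) * real n - h * real (m_tilde G) - \<epsilon> * real n"
  define p where "p \<epsilon> n = measure_pmf.prob (config_model f n) {G. energy_barrier J h G < ?bound \<epsilon> n G}"
    for \<epsilon> n
  obtain k where k: "k \<in> set_pmf f" using set_pmf_not_empty[of f] by blast
  then have "0 < pmf f k" by (simp add: pmf_positive)
  moreover from this have "3 \<le> k" using assms(4) by (meson Least_le order_trans)
  ultimately have "0 < real k * pmf f k" by simp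
  then have \<delta>: "0 < ?\<delta>"
    unfolding mean_degree_def by (intro suminf_pos2[OF assms(5)]) auto
  have "(p \<epsilon> \<longlongrightarrow> 0) ?F" if \<epsilon>: "0 < \<epsilon>" for \<epsilon>
  proof -
    \<comment> \<open>An error of \<open>\<epsilon>\<close> in energy allows an error of \<open>\<epsilon>/J\<close> in the number of cut pairs.\<close>
    have eq: "?bound \<epsilon> n G = J * ((?\<delta> * I_fun ?\<delta> (1/2) - \<epsilon> / J) * real n) - h * m_tilde G" for n G
      using assms(1) by (simp add: field_simps)
    show ?thesis
      unfolding p_def eq using assms \<delta> \<epsilon>
      by (intro tendsto_prob_small_energy_barrier) auto
  qed
  then obtain \<epsilon> where \<epsilon>: "\<epsilon> \<longlonglongrightarrow> 0" "((\<lambda>n. p (\<epsilon> n) n) \<longlongrightarrow> 0) ?F"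
    using exists_null_sequence_diagonal[of p "admissible f"] by blast
  have "measure_pmf.prob (config_model f n) {G. energy_barrier J h G \<ge> ?bound (\<epsilon> n) n G} = 1 - p (\<epsilon> n) n" for n
  proof -
    have compl: "{G. energy_barrier J h G \<ge> ?bound (\<epsilon> n) n G} = UNIV - {G. energy_barrier J h G < ?bound (\<epsilon> n) n G}"
      by auto
    show ?thesis
      unfolding p_def compl
      using measure_pmf.prob_compl[of "{G. energy_barrier J h G < ?bound (\<epsilon> n) n G}" "config_model f n"]
      by simp
  qed
  moreover have "((\<lambda>n. 1 - p (\<epsilon> n) n) \<longlongrightarrow> 1) ?F"
    using tendsto_diff[OF tendsto_const[of 1] \<epsilon>(2)] by simp
  ultimately show ?thesis using \<epsilon>(1) by (intro exI[of _ \<epsilon>]) simp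
qed

end
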